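(* Let $M^2$ be a smooth connected $2$-manifold and let $f:M^2\to S^3_1$ be a CMC-1 face. Then there exists a real analytic normal vector field of $f$ defined on (all of) $M^2$. In particular, $f$ is a co-orientable frontal.
   Context: $\mathbb{R}^4_1$ (metric $-x_0y_0+x_1y_1+x_2y_2+x_3y_3$) is identified with the $2\times 2$ Hermitian matrices by $$(x_0,x_1,x_2,x_3)\leftrightarrow\begin{pmatrix}x_0+x_3&x_1+ix_2\\ x_1-ix_2&x_0-x_3\end{pmatrix},$$ and $S^3_1=\{X=X^*:\det X=-1\}$, where $X^*={}^t\bar X$. Put $e_3=\begin{pmatrix}1&0\\0&-1\end{pmatrix}$. A holomorphic map $F$ from a Riemann surface to $SL(2,\mathbb{C})$ is null if $\det(dF/dz)$ vanishes identically for each local complex coordinate $z$. A $C^\infty$ map $f:M^2\to S^3_1$ is a CMC-1 face if its regular set (where $f$ is an immersion) is open and dense in $M^2$, and for each $p\in M^2$ there exist a neighborhood $U$ of $p$ (with a complex structure) and a null holomorphic immersion $F:U\to SL(2,\mathbb{C})$ such that $f=Fe_3F^*$ on $U$. Real analyticity on $M^2$ refers to the real analytic structure given by these local complex coordinates. A normal vector field of $f$ is a nowhere vanishing map $\eta$ on $M^2$ with $\eta_p\in T_{f(p)}S^3_1\subset\mathbb{R}^4_1$ (i.e. $\langle\eta_p,f(p)\rangle=0$) and $\langle\eta_p,df(T_pM^2)\rangle=0$ for all $p$. A $C^\infty$ map $f:M^2\to N^3$ is a frontal if it lifts to a $C^\infty$ map $L_f:M^2\to P(T^*N^3)$ whose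 differential maps $TM^2$ into the canonical contact hyperplane field; it is co-orientable if $L_f$ lifts to a $C^\infty$ map into $T^*N^3$. *)

theory Defs
  imports "HOL-Analysis.Analysis"
begin

section \<open>Smooth and real analytic maps between Euclidean spaces\<close>

text \<open>The next two notions are meant for open \<open>S\<close>.\<close>

fun Ck_on :: "nat \<Rightarrow> 'd::euclidean_space set \<Rightarrow> ('d \<Rightarrow> 'e::euclidean_space) \<Rightarrow> bool" where
  "Ck_on 0 S f \<longleftrightarrow> continuous_on S f"
| "Ck_on (Suc k) S f \<longleftrightarrow>
     (\<forall>x\<in>S. f differentiable (at x)) \<and>
     (\<forall>v. Ck_on k S (\<lambda>x. frechet_derivative f (at x) v))"

definition smooth_on :: "'d::euclidean_space set \<Rightarrow> ('d \<Rightarrow> 'e::euclidean_space) \<Rightarrow> bool" where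
  "smooth_on S f \<longleftrightarrow> (\<forall>k. Ck_on k S f)"

text \<open>Real analyticity in the two real variables \<open>x, y\<close> of \<open>z = x + iy\<close>.\<close>

definition real_analytic_on :: "complex set \<Rightarrow> (complex \<Rightarrow> 'e::euclidean_space) \<Rightarrow> bool" where
  "real_analytic_on S h \<longleftrightarrow>
     (\<forall>z\<in>S. \<exists>r>0. \<exists>a :: nat \<Rightarrow> nat \<Rightarrow> 'e. \<forall>x y. \<bar>x\<bar> < r \<and> \<bar>y\<bar> < r \<longrightarrow>
        ((\<lambda>(i, j). (x ^ i * y ^ j) *\<^sub>R a i j) has_sum h (z + Complex x y)) UNIV)"


section \<open>Smooth manifolds\<close>

text \<open>A chart is a pair \<open>(U, \<phi>)\<close>; the inverse \<open>\<phi> ` U \<rightarrow> U\<close> is \<open>inv_into U \<phi>\<close>.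
  Manifolds such as \<open>M\<close> are whole types, with Hausdorff and second countable topology supplied
  by the type classes of the type.\<close>

definition is_chart :: "'a::topological_space set \<Rightarrow> ('a \<Rightarrow> 'e::euclidean_space) \<Rightarrow> bool" where
  "is_chart U \<phi> \<longleftrightarrow> open U \<and> open (\<phi> ` U) \<and> homeomorphism U (\<phi> ` U) \<phi> (inv_into U \<phi>)"

definition smooth_atlas :: "('a::topological_space set \<times> ('a \<Rightarrow> 'e::euclidean_space)) set \<Rightarrow> bool" where
  "smooth_atlas A \<longleftrightarrow>
     (\<Union>(U, \<phi>)\<in>A. U) = UNIV \<and>
     (\<forall>(U, \<phi>)\<in>A. is_chart U \<phi>) \<and>
     (\<forall>(U, \<phi>)\<in>A. \<forall>(V, \<psi>)\<in>A. smooth_on (\<phi> ` (U \<inter> V)) (\<psi> \<circ> inv_into U \<phi>))"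

text \<open>The target manifold enters only through its set \<open>B\<close> of charts. Continuity is
  expressed by the requirement that the neighbourhood \<open>W\<close> be mapped into a single chart domain.\<close>

definition smooth_map ::
  "('a::topological_space set \<times> ('a \<Rightarrow> 'd::euclidean_space)) set \<Rightarrow>
   ('b set \<times> ('b \<Rightarrow> 'e::euclidean_space)) set \<Rightarrow> ('a \<Rightarrow> 'b) \<Rightarrow> bool" where
  "smooth_map A B F \<longleftrightarrow>
     (\<forall>p. \<exists>(U, \<phi>)\<in>A. \<exists>(D, \<kappa>)\<in>B. \<exists>W. open W \<and> p \<in> W \<and> W \<subseteq> U \<and> F ` W \<subseteq> D \<and>
        smooth_on (\<phi> ` W) (\<kappa> \<circ> F \<circ> inv_into U \<phi>))"

text \<open>The differential at \<open>p\<close>, expressed in the chart \<open>(U, \<phi>)\<close>, of a map into a vector space.\<close>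

definition differential ::
  "'a set \<times> ('a \<Rightarrow> 'd::euclidean_space) \<Rightarrow> ('a \<Rightarrow> 'e::euclidean_space) \<Rightarrow> 'a \<Rightarrow> 'd \<Rightarrow> 'e" where
  "differential = (\<lambda>(U, \<phi>) F p. frechet_derivative (F \<circ> inv_into U \<phi>) (at (\<phi> p)))"


section \<open>Minkowski space and de Sitter space\<close>

text \<open>The coordinates of a point of Minkowski space are \<open>x $ 0, x $ 1, x $ 2, x $ 3\<close>; the index type
  is the integers modulo 4, so that \<open>0\<close> and \<open>4\<close> denote the same index.\<close>

definition lorentz :: "real^4 \<Rightarrow> real^4 \<Rightarrow> real" where
  "lorentz x y = - (x $ 0 * y $ 0) + x $ 1 * y $ 1 + x $ 2 * y $ 2 + x $ 3 * y $ 3"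

definition herm :: "real^4 \<Rightarrow> complex^2^2" where
  "herm x = vector [vector [complex_of_real (x $ 0 + x $ 3), Complex (x $ 1) (x $ 2)],
                    vector [Complex (x $ 1) (- (x $ 2)), complex_of_real (x $ 0 - x $ 3)]]"

definition ctranspose :: "complex^'n^'m \<Rightarrow> complex^'m^'n" where
  "ctranspose X = (\<chi> i j. cnj (X $ j $ i))"

definition e3 :: "complex^2^2" where
  "e3 = vector [vector [1, 0], vector [0, -1]]"

definition S31 :: "(real^4) set" where
  "S31 = {x. ctranspose (herm x) = herm x \<and> det (herm x) = -1}"

definition tangent_S31 :: "real^4 \<Rightarrow> (real^4) set" where
  "tangent_S31 q = {v. lorentz v q = 0}"

lemma index_4: "i = 0 \<or> i = 1 \<or> i = 2 \<or> i = 3" for i :: 4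
proof -
  have "(4::4) = 0" by simp
  with exhaust_4[of i] show ?thesis by metis
qed

lemma ctranspose_herm: "ctranspose (herm x) = herm x"
  by (simp add: ctranspose_def herm_def vec_eq_iff forall_2 complex_eq_iff)

lemma hermitian_iff: "ctranspose X = X \<longleftrightarrow> (\<exists>x. X = herm x)"
proof
  assume X: "ctranspose X = X"
  define x :: "real^4" where
    "x = (\<chi> i. if i = 0 then Re (X $ 1 $ 1 + X $ 2 $ 2) / 2 else if i = 1 then Re (X $ 1 $ 2)
               else if i = 2 then Im (X $ 1 $ 2) else Re (X $ 1 $ 1 - X $ 2 $ 2) / 2)"
  have "cnj (X $ j $ i) = X $ i $ j" for i j
    using arg_cong[OF X, of "\<lambda>Y. Y $ i $ j"] by (simp add: ctranspose_def)
  from this[of 1 1] this[of 1 2] this[of 2 2]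
  have *: "Im (X $ 1 $ 1) = 0" "Re (X $ 2 $ 1) = Re (X $ 1 $ 2)"
      "Im (X $ 2 $ 1) = - Im (X $ 1 $ 2)" "Im (X $ 2 $ 2) = 0"
    by (simp_all add: complex_eq_iff)
  have "x $ 0 = Re (X $ 1 $ 1 + X $ 2 $ 2) / 2" "x $ 1 = Re (X $ 1 $ 2)"
      "x $ 2 = Im (X $ 1 $ 2)" "x $ 3 = Re (X $ 1 $ 1 - X $ 2 $ 2) / 2"
    by (simp_all add: x_def)
  with * have "X = herm x"
    by (simp add: herm_def vec_eq_iff forall_2 complex_eq_iff)
  then show "\<exists>x. X = herm x" ..
qed (auto simp: ctranspose_herm)

lemma inj_herm: "inj herm"
proof (rule injI)
  fix x y assume eq: "herm x = herm y"
  have "herm x $ i $ j = herm y $ i $ j" for i j by (simp add: eq)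
  from this[of 1 1] this[of 1 2] this[of 2 2]
  have *: "x $ 0 = y $ 0 \<and> x $ 1 = y $ 1 \<and> x $ 2 = y $ 2 \<and> x $ 3 = y $ 3"
    by (simp add: herm_def complex_eq_iff)
  have "x $ i = y $ i" for i
    using index_4[of i] * by (elim disjE) simp_all
  then show "x = y" by (simp add: vec_eq_iff)
qed

lemma det_herm: "det (herm x) = complex_of_real (- lorentz x x)"
  by (simp add: det_2 herm_def lorentz_def complex_eq_iff algebra_simps)

lemma S31_eq: "S31 = {x. lorentz x x = 1}"
  by (auto simp: S31_def ctranspose_herm det_herm complex_eq_iff)

text \<open>All charts of \<open>S31\<close> for its smooth structure as a submanifold: diffeomorphisms from relatively
  open subsets onto open subsets of \<open>real^3\<close>, where smoothness of \<open>\<psi>\<close> on a subset of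
  \<open>S31\<close> means that \<open>\<psi>\<close> is smooth as a map on an open subset of the ambient space.\<close>

definition S31_charts :: "((real^4) set \<times> (real^4 \<Rightarrow> real^3)) set" where
  "S31_charts = {(U, \<psi>). (\<exists>W. open W \<and> U = W \<inter> S31 \<and> smooth_on W \<psi>) \<and>
     inj_on \<psi> U \<and> open (\<psi> ` U) \<and> smooth_on (\<psi> ` U) (inv_into U \<psi>)}"

text \<open>The coordinate vector field \<open>\<partial>/\<partial>x\<^sub>i\<close> of a chart.\<close>

definition coord_vector :: "(real^4) set \<Rightarrow> (real^4 \<Rightarrow> real^3) \<Rightarrow> 3 \<Rightarrow> real^4 \<Rightarrow> real^4" where
  "coord_vector U \<psi> i q = frechet_derivative (inv_into U \<psi>) (at (\<psi> q)) (axis i 1)"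


section \<open>The cotangent bundle, its projectivization, and frontals\<close>

text \<open>A linear functional on the tangent space is represented by the function that extends it by
  zero off the tangent space.\<close>

definition cotangent_space :: "real^4 \<Rightarrow> (real^4 \<Rightarrow> real) set" where
  "cotangent_space q = {\<alpha>.
     (\<forall>u\<in>tangent_S31 q. \<forall>v\<in>tangent_S31 q. \<alpha> (u + v) = \<alpha> u + \<alpha> v) \<and>
     (\<forall>c. \<forall>v\<in>tangent_S31 q. \<alpha> (c *\<^sub>R v) = c * \<alpha> v) \<and>
     (\<forall>v. v \<notin> tangent_S31 q \<longrightarrow> \<alpha> v = 0)}"

definition cotangent_bundle :: "((real^4) \<times> (real^4 \<Rightarrow> real)) set" where
  "cotangent_bundle = {(q, \<alpha>). q \<in> S31 \<and> \<alpha> \<in> cotangent_space q}"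

definition cotangent_charts ::
  "(((real^4) \<times> (real^4 \<Rightarrow> real)) set \<times> ((real^4) \<times> (real^4 \<Rightarrow> real) \<Rightarrow> (real^3) \<times> (real^3))) set" where
  "cotangent_charts =
     {({(q, \<alpha>) \<in> cotangent_bundle. q \<in> U},
       \<lambda>(q, \<alpha>). (\<psi> q, \<chi> i. \<alpha> (coord_vector U \<psi> i q))) | U \<psi>. (U, \<psi>) \<in> S31_charts}"

definition projectivize :: "(real^4) \<times> (real^4 \<Rightarrow> real) \<Rightarrow> (real^4) \<times> (real^4 \<Rightarrow> real) set" where
  "projectivize = (\<lambda>(q, \<alpha>). (q, range (\<lambda>c v. c * \<alpha> v)))"

definition proj_cotangent_bundle :: "((real^4) \<times> (real^4 \<Rightarrow> real) set) set" where
  "proj_cotangent_bundle = projectivize ` {(q, \<alpha>) \<in> cotangent_bundle. \<alpha> \<noteq> (\<lambda>v. 0)}"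

text \<open>Fibre coordinates on the lines \<open>l\<close> not killing \<open>\<partial>\<^sub>j\<close>: normalizing \<open>\<alpha> \<in> l\<close> by
  \<open>\<alpha>(\<partial>\<^sub>j) = 1\<close>, the two remaining components of \<open>\<alpha>\<close>. The type \<open>3\<close> is the integers modulo
  3, so the remaining indices are \<open>j + 1\<close> and \<open>j + 2\<close>.\<close>

definition proj_cotangent_charts ::
  "(((real^4) \<times> (real^4 \<Rightarrow> real) set) set \<times>
    ((real^4) \<times> (real^4 \<Rightarrow> real) set \<Rightarrow> (real^3) \<times> (real^2))) set" where
  "proj_cotangent_charts =
     {({(q, l) \<in> proj_cotangent_bundle. q \<in> U \<and> (\<exists>\<alpha>\<in>l. \<alpha> (coord_vector U \<psi> j q) \<noteq> 0)},
       \<lambda>(q, l). (\<psi> q, let \<alpha> = (THE \<alpha>. \<alpha> \<in> l \<and> \<alpha> (coord_vector U \<psi> j q) = 1)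
                      in vector [\<alpha> (coord_vector U \<psi> (j + 1) q), \<alpha> (coord_vector U \<psi> (j + 2) q)]))
      | U \<psi> j. (U, \<psi>) \<in> S31_charts}"

text \<open>The contact hyperplane at \<open>\<xi> = (q, [\<alpha>])\<close> consists of the tangent vectors \<open>v\<close> with
  \<open>\<alpha>(d\<pi>(v)) = 0\<close>, where \<open>\<pi>(q, [\<alpha>]) = q\<close>. Tangent vectors are given by their components in
  the chart \<open>(D, \<kappa>)\<close>.\<close>

definition contact_hyperplane ::
  "((real^4) \<times> (real^4 \<Rightarrow> real) set) set \<times> ((real^4) \<times> (real^4 \<Rightarrow> real) set \<Rightarrow> (real^3) \<times> (real^2)) \<Rightarrow>
   (real^4) \<times> (real^4 \<Rightarrow> real) set \<Rightarrow> ((real^3) \<times> (real^2)) set" where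
  "contact_hyperplane C \<xi> = {v. \<forall>\<alpha>\<in>snd \<xi>. \<alpha> (differential C fst \<xi> v) = 0}"

definition frontal_lift ::
  "('a::topological_space set \<times> ('a \<Rightarrow> real^2)) set \<Rightarrow> ('a \<Rightarrow> real^4) \<Rightarrow>
   ('a \<Rightarrow> (real^4) \<times> (real^4 \<Rightarrow> real) set) \<Rightarrow> bool" where
  "frontal_lift A f L \<longleftrightarrow>
     (\<forall>p. L p \<in> proj_cotangent_bundle \<and> fst (L p) = f p) \<and>
     smooth_map A proj_cotangent_charts L \<and>
     (\<forall>(U, \<phi>)\<in>A. \<forall>(D, \<kappa>)\<in>proj_cotangent_charts. \<forall>p\<in>U. L p \<in> D \<longrightarrow>
        (\<forall>v. differential (U, \<phi>) (\<kappa> \<circ> L) p v \<in> contact_hyperplane (D, \<kappa>) (L p)))"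

definition frontal ::
  "('a::topological_space set \<times> ('a \<Rightarrow> real^2)) set \<Rightarrow> ('a \<Rightarrow> real^4) \<Rightarrow> bool" where
  "frontal A f \<longleftrightarrow> smooth_map A S31_charts f \<and> (\<exists>L. frontal_lift A f L)"

definition co_orientable_frontal ::
  "('a::topological_space set \<times> ('a \<Rightarrow> real^2)) set \<Rightarrow> ('a \<Rightarrow> real^4) \<Rightarrow> bool" where
  "co_orientable_frontal A f \<longleftrightarrow> frontal A f \<and>
     (\<exists>L. frontal_lift A f L \<and>
        (\<exists>K. (\<forall>p. K p \<in> cotangent_bundle \<and> projectivize (K p) = L p) \<and>
             smooth_map A cotangent_charts K))"


section \<open>CMC-1 faces\<close>

text \<open>A complex structure on the open set \<open>U\<close>, given by a holomorphic atlas \<open>C\<close> whose charts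
  are compatible with the smooth structure of the manifold.\<close>

definition complex_structure ::
  "('a::topological_space set \<times> ('a \<Rightarrow> real^2)) set \<Rightarrow> 'a set \<Rightarrow> ('a set \<times> ('a \<Rightarrow> complex)) set \<Rightarrow> bool" where
  "complex_structure A U C \<longleftrightarrow>
     (\<Union>(V, z)\<in>C. V) = U \<and>
     (\<forall>(V, z)\<in>C. is_chart V z) \<and>
     (\<forall>(V, z)\<in>C. \<forall>(V', z')\<in>C. (z' \<circ> inv_into V z) holomorphic_on (z ` (V \<inter> V'))) \<and>
     (\<forall>(V, z)\<in>C. \<forall>(W, \<phi>)\<in>A. smooth_on (\<phi> ` (W \<inter> V)) (z \<circ> inv_into W \<phi>) \<and>
                             smooth_on (z ` (W \<inter> V)) (\<phi> \<circ> inv_into V z))"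

text \<open>The matrix \<open>dF/dz\<close> at \<open>p\<close> in the complex chart \<open>(V, z)\<close>.\<close>

definition dFdz :: "'a set \<Rightarrow> ('a \<Rightarrow> complex) \<Rightarrow> ('a \<Rightarrow> complex^2^2) \<Rightarrow> 'a \<Rightarrow> complex^2^2" where
  "dFdz V z F p = (\<chi> i j. deriv (\<lambda>w. F (inv_into V z w) $ i $ j) (z p))"

definition null_holomorphic_immersion ::
  "'a set \<Rightarrow> ('a set \<times> ('a \<Rightarrow> complex)) set \<Rightarrow> ('a \<Rightarrow> complex^2^2) \<Rightarrow> bool" where
  "null_holomorphic_immersion U C F \<longleftrightarrow>
     (\<forall>p\<in>U. det (F p) = 1) \<and>
     (\<forall>(V, z)\<in>C. (\<forall>i j. (\<lambda>w. F (inv_into V z w) $ i $ j) holomorphic_on (z ` V)) \<and>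
                 (\<forall>p\<in>V. dFdz V z F p \<noteq> 0 \<and> det (dFdz V z F p) = 0))"

definition cmc1_representation ::
  "('a::topological_space set \<times> ('a \<Rightarrow> real^2)) set \<Rightarrow> ('a \<Rightarrow> real^4) \<Rightarrow>
   'a set \<Rightarrow> ('a set \<times> ('a \<Rightarrow> complex)) set \<Rightarrow> ('a \<Rightarrow> complex^2^2) \<Rightarrow> bool" where
  "cmc1_representation A f U C F \<longleftrightarrow>
     open U \<and> complex_structure A U C \<and> null_holomorphic_immersion U C F \<and>
     (\<forall>p\<in>U. herm (f p) = F p ** e3 ** ctranspose (F p))"

definition regular_set ::
  "('a::topological_space set \<times> ('a \<Rightarrow> real^2)) set \<Rightarrow> ('a \<Rightarrow> real^4) \<Rightarrow> 'a set" where
  "regular_set A f = {p. \<forall>(U, \<phi>)\<in>A. p \<in> U \<longrightarrow> inj (differential (U, \<phi>) f p)}"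

definition cmc1_face ::
  "('a::topological_space set \<times> ('a \<Rightarrow> real^2)) set \<Rightarrow> ('a \<Rightarrow> real^4) \<Rightarrow> bool" where
  "cmc1_face A f \<longleftrightarrow>
     smooth_map A S31_charts f \<and>
     open (regular_set A f) \<and> closure (regular_set A f) = UNIV \<and>
     (\<forall>p. \<exists>U C F. p \<in> U \<and> cmc1_representation A f U C F)"

definition normal_vector_field ::
  "('a::topological_space set \<times> ('a \<Rightarrow> real^2)) set \<Rightarrow> ('a \<Rightarrow> real^4) \<Rightarrow> ('a \<Rightarrow> real^4) \<Rightarrow> bool" where
  "normal_vector_field A f \<eta> \<longleftrightarrow>
     (\<forall>p. \<eta> p \<noteq> 0 \<and> \<eta> p \<in> tangent_S31 (f p)) \<and>
     (\<forall>(U, \<phi>)\<in>A. \<forall>p\<in>U. \<forall>v. lorentz (\<eta> p) (differential (U, \<phi>) f p v) = 0)"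

text \<open>Real analyticity with respect to every local complex coordinate that arises from a local
  representation of the face \<open>f\<close>.\<close>

definition face_real_analytic ::
  "('a::topological_space set \<times> ('a \<Rightarrow> real^2)) set \<Rightarrow> ('a \<Rightarrow> real^4) \<Rightarrow> ('a \<Rightarrow> real^4) \<Rightarrow> bool" where
  "face_real_analytic A f \<eta> \<longleftrightarrow>
     (\<forall>U C F. cmc1_representation A f U C F \<longrightarrow>
        (\<forall>(V, z)\<in>C. real_analytic_on (z ` V) (\<eta> \<circ> inv_into V z)))"

end

theory Submission
  imports Defs "HOL-Complex_Analysis.Cauchy_Integral_Formula"
begin

text \<open>
  Where \<open>f = F e3 F\<^sup>*\<close>, the trace free nilpotent matrix \<open>A = F\<^sup>-\<^sup>1 F'\<close> has rank one, and the Hermitian matrix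
  \<open>N = F (A A\<^sup>* + e3 A\<^sup>* A e3) F\<^sup>*\<close> is normal to \<open>f\<close>, also at the singular points. It is positive
  semidefinite and nonzero, so the vector of \<open>N\<close> has positive time component and can be divided
  by it. At a regular point the normal space is a line, hence the normal with time component 1 does not depend
  on \<open>F\<close> or on the complex structure; regular points being dense, the local normals
  agree everywhere and define a global field. Its components are rational in holomorphic
  functions and their conjugates, so it is real analytic, and the covectors \<open>\<langle>\<eta>, _\<rangle>\<close> give the
  co-oriented lift.\<close>

section \<open>Smooth maps\<close>

text \<open>The unit normal cannot be used: it is timelike at regular points, and its components are
  unbounded near singular points, where the normal direction becomes lightlike. Write
  \<open>A\<close> as a multiple of (g, -g^2; 1, -g). Up to one common positive factor, the two
  summands of \<open>N\<close> are congruent by \<open>F\<close> to (|g|^2, g; conj g, 1) and (1, g;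
  conj g, |g|^2). Both are null vectors orthogonal to df, and their Lorentz products with
  \<open>f\<close> are opposite, so the sum is tangent to de Sitter space. At a regular point they
  span the two null lines of the plane orthogonal to df. The determinant of the sum is a nonnegative
  multiple of (1 - |g|^2)^2. It vanishes where |g| = 1; these are the singular points, where the two
  null vectors coincide and their sum is still nonzero. Stated through \<open>A\<close> and
  \<open>e3\<close> instead of g, the formula also covers the poles of g.\<close>

lemma frechet_derivative_eqI: "(f has_derivative f') (at x) \<Longrightarrow> frechet_derivative f (at x) = f'"
  by (rule frechet_derivative_at[symmetric])

lemma Ck_on_subset: "Ck_on k T f \<Longrightarrow> S \<subseteq> T \<Longrightarrow> Ck_on k S f"
  by (induction k arbitrary: f) (auto intro: continuous_on_subset)

text \<open>On an open set, equality of two functions forces equality of their derivatives at each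
  point, so the induction continues with the directional derivatives.\<close>

lemma Ck_on_cong:
  assumes "open S" "\<And>x. x \<in> S \<Longrightarrow> f x = g x" "Ck_on k S f"
  shows "Ck_on k S g"
  using assms(2,3)
proof (induction k arbitrary: f g)
  case 0
  then show ?case by (simp cong: continuous_on_cong)
next
  case (Suc k)
  have der: "(g has_derivative frechet_derivative f (at x)) (at x)" if "x \<in> S" for x
  proof (rule has_derivative_transform_within_open[OF _ \<open>open S\<close> that])
    show "(f has_derivative frechet_derivative f (at x)) (at x)"
      using Suc.prems that by (auto simp: frechet_derivative_works)
  qed (use Suc.prems in auto)
  show ?case
    unfolding Ck_on.simps
  proof (intro conjI ballI allI)
    fix v
    show "Ck_on k S (\<lambda>x. frechet_derivative g (at x) v)"
    proof (rule Suc.IH)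
      show "frechet_derivative f (at x) v = frechet_derivative g (at x) v" if "x \<in> S" for x
        using frechet_derivative_eqI[OF der[OF that]] by simp
    qed (use Suc.prems in auto)
  qed (use der in \<open>auto simp: differentiable_def\<close>)
qed

text \<open>Lets an explicit formula stand in for \<open>frechet_derivative\<close>; the product,
  chain and quotient rules below all enter through this equivalence.\<close>

lemma Ck_on_Suc_iff:
  assumes "open S" "\<And>x. x \<in> S \<Longrightarrow> (f has_derivative f' x) (at x)"
  shows "Ck_on (Suc k) S f \<longleftrightarrow> (\<forall>v. Ck_on k S (\<lambda>x. f' x v))"
proof -
  have "Ck_on k S (\<lambda>x. frechet_derivative f (at x) v) \<longleftrightarrow> Ck_on k S (\<lambda>x. f' x v)" for v
    using Ck_on_cong[OF assms(1), of "\<lambda>x. frechet_derivative f (at x) v" "\<lambda>x. f' x v"]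
      Ck_on_cong[OF assms(1), of "\<lambda>x. f' x v" "\<lambda>x. frechet_derivative f (at x) v"]
    by (auto simp: frechet_derivative_eqI[OF assms(2)])
  then show ?thesis
    using assms by (auto simp: differentiable_def)
qed

lemma Ck_on_Suc_imp: "Ck_on (Suc k) S f \<Longrightarrow> Ck_on k S f"
proof (induction k arbitrary: f)
  case 0
  then show ?case
    by (auto intro!: continuous_at_imp_continuous_on differentiable_imp_continuous_within)
next
  case (Suc k)
  then show ?case unfolding Ck_on.simps(2) by blast
qed

text \<open>Differentiability and the derivative at a point are determined near that point. This
  later glues smoothness from overlaps of coordinate domains.\<close>

lemma Ck_on_local:
  assumes "\<And>x. x \<in> S \<Longrightarrow> \<exists>T. open T \<and> x \<in> T \<and> Ck_on k T f"
  shows "Ck_on k S f"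
  using assms
proof (induction k arbitrary: f)
  case 0
  show ?case
    unfolding Ck_on.simps
  proof (rule continuous_at_imp_continuous_on, rule ballI)
    fix x assume "x \<in> S"
    with 0 obtain T where "open T" "x \<in> T" "continuous_on T f" by auto
    then show "isCont f x" by (simp add: continuous_on_eq_continuous_at)
  qed
next
  case (Suc k)
  show ?case
    unfolding Ck_on.simps
  proof (intro conjI ballI allI)
    fix x assume "x \<in> S"
    with Suc.prems show "f differentiable at x" by fastforce
  next
    fix v
    show "Ck_on k S (\<lambda>x. frechet_derivative f (at x) v)"
      by (rule Suc.IH) (use Suc.prems in fastforce)
  qed
qed

lemma Ck_on_const: "Ck_on k S (\<lambda>x. c)"
  by (induction k arbitrary: c) simp_all

lemma Ck_on_bounded_linear:
  assumes "bounded_linear L" "open S" "Ck_on k S f"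
  shows "Ck_on k S (\<lambda>x. L (f x))"
  using assms(3)
proof (induction k arbitrary: f)
  case 0
  then show ?case using assms(1) by (simp add: bounded_linear.continuous_on)
next
  case (Suc k)
  have "((\<lambda>x. L (f x)) has_derivative (\<lambda>v. L (frechet_derivative f (at x) v))) (at x)" if "x \<in> S" for x
    using Suc.prems that
    by (intro bounded_linear.has_derivative[OF assms(1)]) (simp add: frechet_derivative_works)
  from Ck_on_Suc_iff[OF \<open>open S\<close> this] Suc show ?case by auto
qed

lemma Ck_on_add:
  assumes "open S" "Ck_on k S f" "Ck_on k S g"
  shows "Ck_on k S (\<lambda>x. f x + g x)"
  using assms(2,3)
proof (induction k arbitrary: f g)
  case 0
  then show ?case by (simp add: continuous_on_add)
next
  case (Suc k)
  have "((\<lambda>x. f x + g x) has_derivative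
      (\<lambda>v. frechet_derivative f (at x) v + frechet_derivative g (at x) v)) (at x)" if "x \<in> S" for x
    using Suc.prems that by (intro has_derivative_add) (simp_all add: frechet_derivative_works)
  from Ck_on_Suc_iff[OF \<open>open S\<close> this] Suc show ?case by auto
qed

lemma Ck_on_sum:
  assumes "open S" "\<And>i. i \<in> I \<Longrightarrow> Ck_on k S (f i)"
  shows "Ck_on k S (\<lambda>x. \<Sum>i\<in>I. f i x)"
  using assms by (induction I rule: infinite_finite_induct) (auto intro: Ck_on_const Ck_on_add)

lemma Ck_on_bilinear:
  assumes "bounded_bilinear B" "open S" "Ck_on k S f" "Ck_on k S g"
  shows "Ck_on k S (\<lambda>x. B (f x) (g x))"
  using assms(3,4)
proof (induction k arbitrary: f g)
  case 0
  then show ?case using assms(1) by (simp add: bounded_bilinear.continuous_on)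
next
  case (Suc k)
  have der: "((\<lambda>x. B (f x) (g x)) has_derivative
      (\<lambda>v. B (f x) (frechet_derivative g (at x) v) + B (frechet_derivative f (at x) v) (g x))) (at x)"
    if "x \<in> S" for x
    using Suc.prems that
    by (intro bounded_bilinear.FDERIV[OF assms(1)]) (simp_all add: frechet_derivative_works)
  show ?case
  proof (rule iffD2[OF Ck_on_Suc_iff[OF \<open>open S\<close> der]], assumption, intro allI Ck_on_add[OF \<open>open S\<close>])
    fix v
    show "Ck_on k S (\<lambda>x. B (f x) (frechet_derivative g (at x) v))"
      by (rule Suc.IH) (use Suc.prems Ck_on_Suc_imp in auto)
    show "Ck_on k S (\<lambda>x. B (frechet_derivative f (at x) v) (g x))"
      by (rule Suc.IH) (use Suc.prems Ck_on_Suc_imp in auto)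
  qed
qed

text \<open>\<open>Ck_on\<close> controls derivatives along fixed directions only, whereas the chain
  rule evaluates the derivative of \<open>g\<close> at a vector that moves with \<open>x\<close>.
  Expanding that vector in \<open>Basis\<close> leaves a sum of products of fixed-direction
  derivatives, to which the induction applies.\<close>

lemma Ck_on_compose:
  assumes "open S" "Ck_on k T g" "Ck_on k S f" "f ` S \<subseteq> T"
  shows "Ck_on k S (g \<circ> f)"
  using assms(2,3)
proof (induction k arbitrary: g)
  case 0
  then show ?case
    using assms(4) by (simp add: continuous_on_compose continuous_on_subset del: comp_apply)
next
  case (Suc k)
  have der: "(g \<circ> f has_derivative (\<lambda>v. \<Sum>b\<in>Basis. (frechet_derivative f (at x) v \<bullet> b) *\<^sub>R
      frechet_derivative g (at (f x)) b)) (at x)" if "x \<in> S" for x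
  proof -
    have f: "(f has_derivative frechet_derivative f (at x)) (at x)"
      using Suc.prems that by (simp add: frechet_derivative_works)
    have g: "(g has_derivative frechet_derivative g (at (f x))) (at (f x))"
      using Suc.prems that assms(4) by (auto simp: frechet_derivative_works)
    have lin: "linear (frechet_derivative g (at (f x)))"
      using g has_derivative_linear by blast
    have "frechet_derivative g (at (f x)) u = (\<Sum>b\<in>Basis. (u \<bullet> b) *\<^sub>R frechet_derivative g (at (f x)) b)" for u
    proof -
      have "frechet_derivative g (at (f x)) u = frechet_derivative g (at (f x)) (\<Sum>b\<in>Basis. (u \<bullet> b) *\<^sub>R b)"
        by (simp add: euclidean_representation)
      then show ?thesis by (simp add: linear_sum[OF lin] linear_scale[OF lin])
    qed
    then have "frechet_derivative g (at (f x)) \<circ> frechet_derivative f (at x) =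
        (\<lambda>v. \<Sum>b\<in>Basis. (frechet_derivative f (at x) v \<bullet> b) *\<^sub>R frechet_derivative g (at (f x)) b)"
      unfolding comp_def by (rule ext)
    with diff_chain_at[OF f g] show ?thesis by (simp only:)
  qed
  show ?case
  proof (rule iffD2[OF Ck_on_Suc_iff[OF \<open>open S\<close> der]], assumption,
      intro allI Ck_on_sum \<open>open S\<close> Ck_on_bilinear[OF bounded_bilinear_scaleR])
    fix v c
    show "Ck_on k S (\<lambda>x. frechet_derivative f (at x) v \<bullet> c)"
      by (rule Ck_on_bounded_linear[OF bounded_linear_inner_left \<open>open S\<close>]) (use Suc.prems in auto)
    have "Ck_on k S ((\<lambda>y. frechet_derivative g (at y) c) \<circ> f)"
      by (rule Suc.IH) (use Suc.prems Ck_on_Suc_imp in auto)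
    then show "Ck_on k S (\<lambda>x. frechet_derivative g (at (f x)) c)"
      by (simp add: comp_def)
  qed
qed

text \<open>The derivative is a product of \<open>inverse f\<close> twice with the derivative of
  \<open>f\<close>, so the induction hypothesis for the same \<open>f\<close> is enough.\<close>

lemma Ck_on_inverse:
  fixes f :: "'d::euclidean_space \<Rightarrow> 'e::{euclidean_space, real_normed_field}"
  assumes "open S" "Ck_on k S f" "\<And>x. x \<in> S \<Longrightarrow> f x \<noteq> 0"
  shows "Ck_on k S (\<lambda>x. inverse (f x))"
  using assms(2)
proof (induction k)
  case 0
  then show ?case using assms(3) by (simp add: continuous_on_inverse)
next
  case (Suc k)
  have der: "((\<lambda>x. inverse (f x)) has_derivative
      (\<lambda>v. - (inverse (f x) * frechet_derivative f (at x) v * inverse (f x)))) (at x)" if "x \<in> S" for x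
    by (rule Deriv.has_derivative_inverse)
      (use Suc.prems that assms(3) in \<open>simp_all add: frechet_derivative_works\<close>)
  show ?case
    by (rule iffD2[OF Ck_on_Suc_iff[OF \<open>open S\<close> der]], assumption, intro allI \<open>open S\<close>
        Ck_on_bounded_linear[OF bounded_linear_minus[OF bounded_linear_ident]]
        Ck_on_bilinear[OF bounded_bilinear_mult] Suc.IH Ck_on_Suc_imp[OF Suc.prems])
      (use Suc.prems in auto)
qed

text \<open>The real derivative in direction \<open>v\<close> is \<open>deriv h x * v\<close>, again
  holomorphic in \<open>x\<close>, so the hypothesis reproduces itself.\<close>

lemma Ck_on_holomorphic:
  assumes "open S" "h holomorphic_on S"
  shows "Ck_on k S h"
  using assms(2)
proof (induction k arbitrary: h)
  case 0
  then show ?case by (simp add: holomorphic_on_imp_continuous_on)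
next
  case (Suc k)
  have "(h has_derivative (\<lambda>v. deriv h x * v)) (at x)" if "x \<in> S" for x
    using holomorphic_derivI[OF Suc.prems \<open>open S\<close> that] by (simp add: has_field_derivative_def)
  from Ck_on_Suc_iff[OF \<open>open S\<close> this] show ?case
    by (auto intro!: Suc.IH holomorphic_intros holomorphic_deriv Suc.prems \<open>open S\<close>)
qed

lemma smooth_on_subset: "smooth_on T f \<Longrightarrow> S \<subseteq> T \<Longrightarrow> smooth_on S f"
  by (auto simp: smooth_on_def intro: Ck_on_subset)

lemma smooth_on_cong: "open S \<Longrightarrow> (\<And>x. x \<in> S \<Longrightarrow> f x = g x) \<Longrightarrow> smooth_on S f \<Longrightarrow> smooth_on S g"
  unfolding smooth_on_def using Ck_on_cong by blast

lemma smooth_on_local: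
  "(\<And>x. x \<in> S \<Longrightarrow> \<exists>T. open T \<and> x \<in> T \<and> smooth_on T f) \<Longrightarrow> smooth_on S f"
  unfolding smooth_on_def by (meson Ck_on_local)

lemma smooth_on_compose:
  "open S \<Longrightarrow> smooth_on T g \<Longrightarrow> smooth_on S f \<Longrightarrow> f ` S \<subseteq> T \<Longrightarrow> smooth_on S (g \<circ> f)"
  unfolding smooth_on_def using Ck_on_compose by blast

lemma smooth_on_add:
  "open S \<Longrightarrow> smooth_on S f \<Longrightarrow> smooth_on S g \<Longrightarrow> smooth_on S (\<lambda>x. f x + g x)"
  unfolding smooth_on_def using Ck_on_add by blast

lemma smooth_on_sum:
  "open S \<Longrightarrow> (\<And>i. i \<in> I \<Longrightarrow> smooth_on S (f i)) \<Longrightarrow> smooth_on S (\<lambda>x. \<Sum>i\<in>I. f i x)"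
  by (simp add: smooth_on_def Ck_on_sum)

lemma smooth_on_bounded_linear:
  "bounded_linear L \<Longrightarrow> open S \<Longrightarrow> smooth_on S f \<Longrightarrow> smooth_on S (\<lambda>x. L (f x))"
  unfolding smooth_on_def using Ck_on_bounded_linear by blast

lemma smooth_on_bilinear:
  "bounded_bilinear B \<Longrightarrow> open S \<Longrightarrow> smooth_on S f \<Longrightarrow> smooth_on S g \<Longrightarrow> smooth_on S (\<lambda>x. B (f x) (g x))"
  unfolding smooth_on_def using Ck_on_bilinear by blast

lemma smooth_on_inverse:
  fixes f :: "'d::euclidean_space \<Rightarrow> 'e::{euclidean_space, real_normed_field}"
  shows "open S \<Longrightarrow> smooth_on S f \<Longrightarrow> (\<And>x. x \<in> S \<Longrightarrow> f x \<noteq> 0) \<Longrightarrow> smooth_on S (\<lambda>x. inverse (f x))"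
  unfolding smooth_on_def using Ck_on_inverse by blast

lemma smooth_on_holomorphic: "open S \<Longrightarrow> h holomorphic_on S \<Longrightarrow> smooth_on S h"
  by (simp add: smooth_on_def Ck_on_holomorphic)

lemma smooth_on_differentiable: "smooth_on S f \<Longrightarrow> x \<in> S \<Longrightarrow> f differentiable at x"
  unfolding smooth_on_def using Ck_on.simps(2) by blast

lemma smooth_on_has_derivative:
  "smooth_on S f \<Longrightarrow> x \<in> S \<Longrightarrow> (f has_derivative frechet_derivative f (at x)) (at x)"
  using smooth_on_differentiable frechet_derivative_works by blast

lemma smooth_on_frechet_derivative: "smooth_on S f \<Longrightarrow> smooth_on S (\<lambda>x. frechet_derivative f (at x) v)"
  unfolding smooth_on_def by (metis Ck_on.simps(2))

lemma smooth_on_continuous: "smooth_on S f \<Longrightarrow> continuous_on S f"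
  unfolding smooth_on_def using Ck_on.simps(1) by blast

lemma smooth_on_Pair:
  assumes "open S" "smooth_on S f" "smooth_on S g"
  shows "smooth_on S (\<lambda>x. (f x, g x))"
proof -
  have "smooth_on S (\<lambda>x. (f x, 0) + (0, g x))"
    by (intro smooth_on_add smooth_on_bounded_linear[where L = "\<lambda>u. (u, 0)"]
        smooth_on_bounded_linear[where L = "\<lambda>u. (0, u)"] assms bounded_linear_Pair
        bounded_linear_ident bounded_linear_zero)
  then show ?thesis by simp
qed

lemma bounded_linear_axis: "bounded_linear (axis i :: real \<Rightarrow> real^'n)"
proof -
  have "linear (axis i :: real \<Rightarrow> real^'n)"
    by (rule linearI) (auto simp: axis_def vec_eq_iff)
  then show ?thesis by (simp add: linear_conv_bounded_linear)
qed

lemma sum_axis: "(\<Sum>i\<in>UNIV. axis i (v $ i)) = v" for v :: "real^'n"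
  by (simp add: vec_eq_iff axis_def sum.delta cong: if_cong)

lemma smooth_on_vec:
  fixes f :: "'d::euclidean_space \<Rightarrow> real^'n"
  assumes "open S" "\<And>i. smooth_on S (\<lambda>x. f x $ i)"
  shows "smooth_on S f"
proof -
  have "smooth_on S (\<lambda>x. \<Sum>i\<in>UNIV. axis i (f x $ i))"
    by (intro smooth_on_sum smooth_on_bounded_linear[OF bounded_linear_axis] assms)
  then show ?thesis by (simp add: sum_axis)
qed

section \<open>Real analytic functions of two real variables\<close>

text \<open>The constant \<open>M\<close> bounds the majorant \<open>\<Sum> \<bar>a\<^sub>i\<^sub>j\<bar> r\<^sup>i\<^sup>+\<^sup>j\<close>. It is submultiplicative in \<open>g\<close>, and this
  is what makes the substitution of \<open>g\<close> into a power series, hence \<open>1 / g\<close>, converge.\<close>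

definition dseries :: "real \<Rightarrow> real \<Rightarrow> (real \<Rightarrow> real \<Rightarrow> 'e::banach) \<Rightarrow> bool" where
  "dseries r M g \<longleftrightarrow> 0 < r \<and> (\<exists>a W. W \<le> M \<and>
     ((\<lambda>s. norm (a s) * (r ^ fst s * r ^ snd s)) has_sum W) (UNIV :: (nat \<times> nat) set) \<and>
     (\<forall>x y. \<bar>x\<bar> \<le> r \<longrightarrow> \<bar>y\<bar> \<le> r \<longrightarrow> ((\<lambda>s. (x ^ fst s * y ^ snd s) *\<^sub>R a s) has_sum g x y) UNIV))"

text \<open>Regrouping: any absolutely convergent family of monomials will do, however indexed.\<close>

lemma dseriesI:
  fixes c :: "'s \<Rightarrow> 'e::banach" and p q :: "'s \<Rightarrow> nat"
  assumes "0 < r"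
    and W: "((\<lambda>s. norm (c s) * (r ^ p s * r ^ q s)) has_sum W) UNIV" and "W \<le> M"
    and G: "\<And>x y. \<bar>x\<bar> \<le> r \<Longrightarrow> \<bar>y\<bar> \<le> r \<Longrightarrow> ((\<lambda>s. (x ^ p s * y ^ q s) *\<^sub>R c s) has_sum g x y) UNIV"
  shows "dseries r M g"
proof -
  \<comment> \<open>\<open>fib u\<close> gathers the indices whose monomial has exponents
    \<open>u\<close>. The sum of \<open>c\<close> over it is the coefficient of the regrouped
    series, and the sum of norms bounds that coefficient.\<close>
  define fib where "fib = (\<lambda>u. {s. p s = fst u \<and> q s = snd u})"
  define a where "a = (\<lambda>u. infsum c (fib u))"
  define b where "b = (\<lambda>u. infsum (\<lambda>s. norm (c s)) (fib u))"
  have bij: "bij_betw (\<lambda>s. ((p s, q s), s)) UNIV (Sigma UNIV fib)"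
    by (rule bij_betw_byWitness[where f' = snd]) (auto simp: fib_def)
  have abs: "c abs_summable_on fib u" for u
  proof -
    have "(\<lambda>s. norm (c s) * (r ^ p s * r ^ q s)) summable_on fib u"
      using W summable_on_subset_banach summable_on_def by blast
    also have "(\<lambda>s. norm (c s) * (r ^ p s * r ^ q s)) summable_on fib u \<longleftrightarrow>
        (\<lambda>s. norm (c s) * (r ^ fst u * r ^ snd u)) summable_on fib u"
      by (rule summable_on_cong) (simp add: fib_def)
    finally show ?thesis
      using \<open>0 < r\<close> by (simp add: summable_on_cmult_left')
  qed
  have c: "(c has_sum a u) (fib u)" for u
    unfolding a_def using abs abs_summable_summable has_sum_infsum by blast
  have nc: "((\<lambda>s. norm (c s)) has_sum b u) (fib u)" for u
    unfolding b_def using abs has_sum_infsum by blast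
  have G': "((\<lambda>u. (x ^ fst u * y ^ snd u) *\<^sub>R a u) has_sum g x y) UNIV" if "\<bar>x\<bar> \<le> r" "\<bar>y\<bar> \<le> r" for x y
  proof (rule has_sum_SigmaD)
    have "((\<lambda>s. (\<lambda>(u, s). (x ^ fst u * y ^ snd u) *\<^sub>R c s) ((p s, q s), s)) has_sum g x y) UNIV"
      using G[OF that] by simp
    then show "((\<lambda>(u, s). (x ^ fst u * y ^ snd u) *\<^sub>R c s) has_sum g x y) (Sigma UNIV fib)"
      by (subst (asm) has_sum_reindex_bij_betw[OF bij])
    show "((\<lambda>s. case (u, s) of (u, s) \<Rightarrow> (x ^ fst u * y ^ snd u) *\<^sub>R c s) has_sum
        (x ^ fst u * y ^ snd u) *\<^sub>R a u) (fib u)" for u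
      using has_sum_bounded_linear[OF bounded_linear_scaleR_right c] by simp
  qed
  have W': "((\<lambda>u. b u * (r ^ fst u * r ^ snd u)) has_sum W) UNIV"
  proof (rule has_sum_SigmaD)
    have "((\<lambda>s. (\<lambda>(u, s). norm (c s) * (r ^ fst u * r ^ snd u)) ((p s, q s), s)) has_sum W) UNIV"
      using W by simp
    then show "((\<lambda>(u, s). norm (c s) * (r ^ fst u * r ^ snd u)) has_sum W) (Sigma UNIV fib)"
      by (subst (asm) has_sum_reindex_bij_betw[OF bij])
    show "((\<lambda>s. case (u, s) of (u, s) \<Rightarrow> norm (c s) * (r ^ fst u * r ^ snd u)) has_sum
        b u * (r ^ fst u * r ^ snd u)) (fib u)" for u
      using has_sum_cmult_left[OF nc] by simp
  qed
  have le: "norm (a u) * (r ^ fst u * r ^ snd u) \<le> b u * (r ^ fst u * r ^ snd u)" for u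
    unfolding a_def b_def using norm_infsum_bound[OF abs] \<open>0 < r\<close> by (intro mult_right_mono) auto
  have sm: "(\<lambda>u. norm (a u) * (r ^ fst u * r ^ snd u)) summable_on UNIV"
    by (rule summable_on_comparison_test[OF has_sum_imp_summable[OF W']]) (use le \<open>0 < r\<close> in auto)
  have "infsum (\<lambda>u. norm (a u) * (r ^ fst u * r ^ snd u)) UNIV \<le> W"
    using has_sum_mono[OF has_sum_infsum[OF sm] W'] le by simp
  with \<open>W \<le> M\<close> has_sum_infsum[OF sm] G' \<open>0 < r\<close> show ?thesis
    unfolding dseries_def by (meson order_trans)
qed

text \<open>On the closed square each monomial is at most its value at (r, r), so the majorant
  dominates the sum. In particular \<open>M\<close> is nonnegative, which the product and
  composition rules use.\<close>

lemma dseries_bound: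
  assumes "dseries r M g" "\<bar>x\<bar> \<le> r" "\<bar>y\<bar> \<le> r"
  shows "norm (g x y) \<le> M"
proof -
  from assms obtain a W where "0 < r" "W \<le> M"
    and W: "((\<lambda>s. norm (a s) * (r ^ fst s * r ^ snd s)) has_sum W) UNIV"
    and G: "((\<lambda>s. (x ^ fst s * y ^ snd s) *\<^sub>R a s) has_sum g x y) UNIV"
    unfolding dseries_def by blast
  have "norm (g x y) \<le> W"
  proof (rule norm_infsum_le[OF G W])
    fix s
    have "\<bar>x\<bar> ^ fst s * \<bar>y\<bar> ^ snd s \<le> r ^ fst s * r ^ snd s"
      using assms by (intro mult_mono power_mono) auto
    then show "norm ((x ^ fst s * y ^ snd s) *\<^sub>R a s) \<le> norm (a s) * (r ^ fst s * r ^ snd s)"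
      by (simp add: abs_mult power_abs mult.commute mult_left_mono)
  qed
  with \<open>W \<le> M\<close> show ?thesis by simp
qed

lemma dseries_mono: "dseries r M g \<Longrightarrow> M \<le> N \<Longrightarrow> dseries r N g"
  unfolding dseries_def by (meson order_trans)

lemma dseries_cong:
  assumes "dseries r M g" "\<And>x y. \<bar>x\<bar> \<le> r \<Longrightarrow> \<bar>y\<bar> \<le> r \<Longrightarrow> g x y = h x y"
  shows "dseries r M h"
proof -
  have "(\<forall>x y. \<bar>x\<bar> \<le> r \<longrightarrow> \<bar>y\<bar> \<le> r \<longrightarrow> (t x y has_sum g x y) UNIV) \<longleftrightarrow>
      (\<forall>x y. \<bar>x\<bar> \<le> r \<longrightarrow> \<bar>y\<bar> \<le> r \<longrightarrow> (t x y has_sum h x y) UNIV)"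
    for t :: "real \<Rightarrow> real \<Rightarrow> nat \<times> nat \<Rightarrow> 'a"
    using assms(2) by simp
  with assms(1) show ?thesis unfolding dseries_def by (simp only:)
qed

lemma dseries_shrink:
  assumes "dseries r M g" "0 < r'" "r' \<le> r"
  shows "dseries r' M g"
proof -
  from assms obtain a W where "0 < r" "W \<le> M"
    and W: "((\<lambda>s. norm (a s) * (r ^ fst s * r ^ snd s)) has_sum W) UNIV"
    and G: "\<And>x y. \<bar>x\<bar> \<le> r \<Longrightarrow> \<bar>y\<bar> \<le> r \<Longrightarrow> ((\<lambda>s. (x ^ fst s * y ^ snd s) *\<^sub>R a s) has_sum g x y) UNIV"
    unfolding dseries_def by blast
  have le: "norm (a s) * (r' ^ fst s * r' ^ snd s) \<le> norm (a s) * (r ^ fst s * r ^ snd s)" for s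
    using assms by (intro mult_left_mono mult_mono power_mono) auto
  have sm: "(\<lambda>s. norm (a s) * (r' ^ fst s * r' ^ snd s)) summable_on UNIV"
    by (rule summable_on_comparison_test[OF has_sum_imp_summable[OF W]]) (use le assms in auto)
  show ?thesis
  proof (rule dseriesI[OF \<open>0 < r'\<close> has_sum_infsum[OF sm]])
    have "infsum (\<lambda>s. norm (a s) * (r' ^ fst s * r' ^ snd s)) UNIV \<le> W"
      using has_sum_mono[OF has_sum_infsum[OF sm] W] le by simp
    with \<open>W \<le> M\<close> show "infsum (\<lambda>s. norm (a s) * (r' ^ fst s * r' ^ snd s)) UNIV \<le> M" by simp
  qed (use G assms in auto)
qed

text \<open>Without constant term every monomial has degree at least 1 and gains a factor
  \<open>r' / r\<close>. This is how a majorant is made as small as a geometric series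
  requires.\<close>

lemma dseries_shrink_zero:
  assumes "dseries r M g" "0 < r'" "r' \<le> r" "g 0 0 = 0"
  shows "dseries r' (r' / r * M) g"
proof -
  from assms obtain a W where "0 < r" "W \<le> M"
    and W: "((\<lambda>s. norm (a s) * (r ^ fst s * r ^ snd s)) has_sum W) UNIV"
    and G: "\<And>x y. \<bar>x\<bar> \<le> r \<Longrightarrow> \<bar>y\<bar> \<le> r \<Longrightarrow> ((\<lambda>s. (x ^ fst s * y ^ snd s) *\<^sub>R a s) has_sum g x y) UNIV"
    unfolding dseries_def by blast
  have "((\<lambda>s. (0 ^ fst s * 0 ^ snd s) *\<^sub>R a s) has_sum a (0, 0)) UNIV"
    by (rule has_sum_finite_neutralI[where B = "{(0, 0)}"]) (auto simp: power_0_left)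
  with G[of 0 0] \<open>0 < r\<close> \<open>g 0 0 = 0\<close> have a0: "a (0, 0) = 0"
    using has_sum_unique by fastforce
  have le: "norm (a s) * (r' ^ fst s * r' ^ snd s) \<le> r' / r * (norm (a s) * (r ^ fst s * r ^ snd s))" for s
  proof (cases "s = (0, 0)")
    case False
    have q: "0 \<le> r' / r" "r' / r \<le> 1" using assms \<open>0 < r\<close> by auto
    have "(r' / r) ^ (fst s + snd s) \<le> (r' / r) ^ 1"
      using q False by (intro power_decreasing) (auto simp: prod_eq_iff)
    then have "(r' / r) ^ (fst s + snd s) * r ^ (fst s + snd s) \<le> r' / r * r ^ (fst s + snd s)"
      using \<open>0 < r\<close> by (intro mult_right_mono) auto
    then have "r' ^ (fst s + snd s) \<le> r' / r * r ^ (fst s + snd s)"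
      using \<open>0 < r\<close> by (simp add: power_divide)
    then have "norm (a s) * r' ^ (fst s + snd s) \<le> norm (a s) * (r' / r * r ^ (fst s + snd s))"
      by (rule mult_left_mono) simp
    then show ?thesis by (simp add: power_add mult_ac)
  qed (simp add: a0)
  have W': "((\<lambda>s. r' / r * (norm (a s) * (r ^ fst s * r ^ snd s))) has_sum r' / r * W) UNIV"
    by (rule has_sum_cmult_right[OF W])
  have sm: "(\<lambda>s. norm (a s) * (r' ^ fst s * r' ^ snd s)) summable_on UNIV"
    by (rule summable_on_comparison_test[OF has_sum_imp_summable[OF W']]) (use le assms in auto)
  show ?thesis
  proof (rule dseriesI[OF \<open>0 < r'\<close> has_sum_infsum[OF sm]])
    have "infsum (\<lambda>s. norm (a s) * (r' ^ fst s * r' ^ snd s)) UNIV \<le> r' / r * W"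
      using has_sum_mono[OF has_sum_infsum[OF sm] W'] le by simp
    also have "\<dots> \<le> r' / r * M"
      using \<open>W \<le> M\<close> \<open>0 < r\<close> assms by (intro mult_left_mono) auto
    finally show "infsum (\<lambda>s. norm (a s) * (r' ^ fst s * r' ^ snd s)) UNIV \<le> r' / r * M" .
  qed (use G assms in auto)
qed

lemma dseries_const: "0 < r \<Longrightarrow> dseries r (norm c) (\<lambda>x y. c)"
  by (rule dseriesI[where c = "\<lambda>_::unit. c" and p = "\<lambda>_. 0" and q = "\<lambda>_. 0" and W = "norm c"])
    (auto intro!: has_sum_finiteI simp: UNIV_unit)

text \<open>Two monomials indexed by a boolean: x with coefficient 1 and y with coefficient
  \<open>\<i>\<close>. Each contributes \<open>r\<close> to the majorant.\<close>

lemma dseries_Complex: "0 < r \<Longrightarrow> dseries r (2 * r) Complex"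
  by (rule dseriesI[where c = "\<lambda>b. if b then 1 else \<i>" and p = "of_bool" and q = "\<lambda>b. of_bool (\<not> b)"
        and W = "2 * r"])
    (auto intro!: has_sum_finiteI simp: UNIV_bool complex_eq_iff)

lemma dseries_bounded_linear:
  assumes "bounded_linear L" "dseries r M g"
  shows "\<exists>N. dseries r N (\<lambda>x y. L (g x y))"
proof -
  from assms obtain a W where "0 < r" "W \<le> M"
    and W: "((\<lambda>s. norm (a s) * (r ^ fst s * r ^ snd s)) has_sum W) UNIV"
    and G: "\<And>x y. \<bar>x\<bar> \<le> r \<Longrightarrow> \<bar>y\<bar> \<le> r \<Longrightarrow> ((\<lambda>s. (x ^ fst s * y ^ snd s) *\<^sub>R a s) has_sum g x y) UNIV"
    unfolding dseries_def by blast
  obtain K where K: "\<And>v. norm (L v) \<le> norm v * K"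
    using bounded_linear.bounded[OF assms(1)] by blast
  have sm: "(\<lambda>s. norm (L (a s)) * (r ^ fst s * r ^ snd s)) summable_on UNIV"
  proof (rule summable_on_comparison_test[OF has_sum_imp_summable[OF has_sum_cmult_right[OF W]]])
    show "norm (L (a s)) * (r ^ fst s * r ^ snd s) \<le> K * (norm (a s) * (r ^ fst s * r ^ snd s))" for s
      using mult_right_mono[OF K, of "r ^ fst s * r ^ snd s" "a s"] \<open>0 < r\<close> by (simp add: mult_ac)
  qed (use \<open>0 < r\<close> in auto)
  have "dseries r (infsum (\<lambda>s. norm (L (a s)) * (r ^ fst s * r ^ snd s)) UNIV) (\<lambda>x y. L (g x y))"
    by (rule dseriesI[OF \<open>0 < r\<close> has_sum_infsum[OF sm] order_refl])
      (use has_sum_bounded_linear[OF assms(1) G] in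
        \<open>simp add: linear_scale[OF bounded_linear.linear[OF assms(1)]]\<close>)
  then show ?thesis ..
qed

text \<open>Summable majorants make the family of all monomials of all members absolutely summable,
  so it can be indexed by pairs and handed to \<open>dseriesI\<close>. Sums, products and
  substitution into a power series are instances, with a boolean, a monomial of one factor, and an
  exponent as index.\<close>

lemma dseries_has_sum:
  fixes g :: "'k \<Rightarrow> real \<Rightarrow> real \<Rightarrow> 'e::banach"
  assumes "0 < r" and g: "\<And>k. dseries r (M k) (g k)" and M: "(M has_sum N) UNIV"
    and G: "\<And>x y. \<bar>x\<bar> \<le> r \<Longrightarrow> \<bar>y\<bar> \<le> r \<Longrightarrow> ((\<lambda>k. g k x y) has_sum G x y) UNIV"
  shows "dseries r N G"
proof -
  from g have "\<forall>k. \<exists>a W. W \<le> M k \<and> ((\<lambda>s. norm (a s) * (r ^ fst s * r ^ snd s)) has_sum W) UNIV \<and>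
     (\<forall>x y. \<bar>x\<bar> \<le> r \<longrightarrow> \<bar>y\<bar> \<le> r \<longrightarrow> ((\<lambda>s. (x ^ fst s * y ^ snd s) *\<^sub>R a s) has_sum g k x y) UNIV)"
    unfolding dseries_def by blast
  from choice[OF this] obtain a where "\<forall>k. \<exists>W. W \<le> M k \<and>
      ((\<lambda>s. norm (a k s) * (r ^ fst s * r ^ snd s)) has_sum W) UNIV \<and>
      (\<forall>x y. \<bar>x\<bar> \<le> r \<longrightarrow> \<bar>y\<bar> \<le> r \<longrightarrow> ((\<lambda>s. (x ^ fst s * y ^ snd s) *\<^sub>R a k s) has_sum g k x y) UNIV)" ..
  from choice[OF this] obtain W where aW: "\<forall>k. W k \<le> M k \<and>
      ((\<lambda>s. norm (a k s) * (r ^ fst s * r ^ snd s)) has_sum W k) UNIV \<and>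
      (\<forall>x y. \<bar>x\<bar> \<le> r \<longrightarrow> \<bar>y\<bar> \<le> r \<longrightarrow> ((\<lambda>s. (x ^ fst s * y ^ snd s) *\<^sub>R a k s) has_sum g k x y) UNIV)" ..
  then have WM: "\<And>k. W k \<le> M k"
    and W: "\<And>k. ((\<lambda>s. norm (a k s) * (r ^ fst s * r ^ snd s)) has_sum W k) UNIV"
    and g': "\<And>k x y. \<bar>x\<bar> \<le> r \<Longrightarrow> \<bar>y\<bar> \<le> r \<Longrightarrow>
      ((\<lambda>s. (x ^ fst s * y ^ snd s) *\<^sub>R a k s) has_sum g k x y) UNIV"
    by simp_all
  have W0: "0 \<le> W k" for k
    by (rule has_sum_nonneg[OF W]) (use \<open>0 < r\<close> in auto)
  have smW: "W summable_on UNIV"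
    by (rule summable_on_comparison_test[OF has_sum_imp_summable[OF M]]) (use WM W0 in auto)
  define w where "w = (\<lambda>(k, s). norm (a k s) * (r ^ fst s * r ^ snd s))"
  have smw: "w summable_on Sigma UNIV (\<lambda>_. UNIV)"
    by (rule summable_on_SigmaI[OF _ smW]) (use W \<open>0 < r\<close> in \<open>auto simp: w_def\<close>)
  have w: "(w has_sum infsum W UNIV) (Sigma UNIV (\<lambda>_. UNIV))"
    by (rule has_sum_SigmaI[OF _ has_sum_infsum[OF smW] smw]) (use W in \<open>simp add: w_def\<close>)
  show ?thesis
  proof (rule dseriesI[OF \<open>0 < r\<close>])
    show "((\<lambda>u. norm ((\<lambda>(k, s). a k s) u) * (r ^ (fst \<circ> snd) u * r ^ (snd \<circ> snd) u)) has_sum infsum W UNIV) UNIV"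
      using w by (simp add: w_def case_prod_beta')
    show "infsum W UNIV \<le> N"
      using has_sum_mono[OF has_sum_infsum[OF smW] M] WM by simp
    fix x y :: real assume xy: "\<bar>x\<bar> \<le> r" "\<bar>y\<bar> \<le> r"
    define t where "t = (\<lambda>(k, s). (x ^ fst s * y ^ snd s) *\<^sub>R a k s)"
    have "t abs_summable_on Sigma UNIV (\<lambda>_. UNIV)"
    proof (rule Infinite_Sum.abs_summable_on_comparison_test'[OF smw])
      fix u :: "'k \<times> nat \<times> nat"
      have "\<bar>x\<bar> ^ fst (snd u) * \<bar>y\<bar> ^ snd (snd u) \<le> r ^ fst (snd u) * r ^ snd (snd u)"
        using xy by (intro mult_mono power_mono) auto
      then show "norm (t u) \<le> w u"
        by (simp add: t_def w_def case_prod_beta abs_mult power_abs mult.commute mult_left_mono)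
    qed
    then have "(t has_sum G x y) (Sigma UNIV (\<lambda>_. UNIV))"
      by (intro has_sum_SigmaI[OF _ G[OF xy] abs_summable_summable]) (use g'[OF xy] in \<open>simp_all add: t_def\<close>)
    then show "((\<lambda>u. (x ^ (fst \<circ> snd) u * y ^ (snd \<circ> snd) u) *\<^sub>R (\<lambda>(k, s). a k s) u) has_sum G x y) UNIV"
      by (simp add: t_def case_prod_beta')
  qed
qed

lemma dseries_add:
  assumes "dseries r M g" "dseries r N h"
  shows "dseries r (M + N) (\<lambda>x y. g x y + h x y)"
proof (rule dseries_has_sum[where g = "\<lambda>b. if b then g else h" and M = "\<lambda>b. if b then M else N"])
  show "0 < r" using assms by (simp add: dseries_def)
qed (use assms in \<open>auto intro!: has_sum_finiteI simp: UNIV_bool add.commute\<close>)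

text \<open>Each monomial of \<open>g\<close> times \<open>h\<close> is a shifted copy of the series
  of \<open>h\<close>, with majorant scaled by that of the monomial; these copies are then
  summed.\<close>

lemma dseries_mult:
  fixes g h :: "real \<Rightarrow> real \<Rightarrow> complex"
  assumes "dseries r M g" "dseries r N h"
  shows "dseries r (M * N) (\<lambda>x y. g x y * h x y)"
proof -
  from assms obtain a W where "0 < r" "W \<le> M"
    and W: "((\<lambda>s. norm (a s) * (r ^ fst s * r ^ snd s)) has_sum W) UNIV"
    and g: "\<And>x y. \<bar>x\<bar> \<le> r \<Longrightarrow> \<bar>y\<bar> \<le> r \<Longrightarrow> ((\<lambda>s. (x ^ fst s * y ^ snd s) *\<^sub>R a s) has_sum g x y) UNIV"
    unfolding dseries_def by blast
  have W0: "0 \<le> W" by (rule has_sum_nonneg[OF W]) (use \<open>0 < r\<close> in auto)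
  have "dseries r (W * N) (\<lambda>x y. g x y * h x y)"
  proof (rule dseries_has_sum[where M = "\<lambda>s. (norm (a s) * (r ^ fst s * r ^ snd s)) * N"
        and g = "\<lambda>s x y. (x ^ fst s * y ^ snd s) *\<^sub>R a s * h x y"])
    fix s :: "nat \<times> nat"
    from assms obtain b V where "V \<le> N"
      and V: "((\<lambda>s. norm (b s) * (r ^ fst s * r ^ snd s)) has_sum V) UNIV"
      and h: "\<And>x y. \<bar>x\<bar> \<le> r \<Longrightarrow> \<bar>y\<bar> \<le> r \<Longrightarrow> ((\<lambda>s. (x ^ fst s * y ^ snd s) *\<^sub>R b s) has_sum h x y) UNIV"
      unfolding dseries_def by blast
    show "dseries r ((norm (a s) * (r ^ fst s * r ^ snd s)) * N) (\<lambda>x y. (x ^ fst s * y ^ snd s) *\<^sub>R a s * h x y)"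
    proof (rule dseriesI[where c = "\<lambda>t. a s * b t" and p = "\<lambda>t. fst s + fst t" and q = "\<lambda>t. snd s + snd t"])
      show "((\<lambda>t. norm (a s * b t) * (r ^ (fst s + fst t) * r ^ (snd s + snd t))) has_sum
          (norm (a s) * (r ^ fst s * r ^ snd s)) * V) UNIV"
        using has_sum_cmult_right[OF V, of "norm (a s) * (r ^ fst s * r ^ snd s)"]
        by (simp add: norm_mult power_add mult_ac)
      show "(norm (a s) * (r ^ fst s * r ^ snd s)) * V \<le> (norm (a s) * (r ^ fst s * r ^ snd s)) * N"
        using \<open>V \<le> N\<close> \<open>0 < r\<close> by (intro mult_left_mono) auto
      show "((\<lambda>t. (x ^ (fst s + fst t) * y ^ (snd s + snd t)) *\<^sub>R (a s * b t)) has_sum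
          (x ^ fst s * y ^ snd s) *\<^sub>R a s * h x y) UNIV" if "\<bar>x\<bar> \<le> r" "\<bar>y\<bar> \<le> r" for x y
        using has_sum_cmult_right[OF h[OF that], of "(x ^ fst s * y ^ snd s) *\<^sub>R a s"]
        by (simp add: power_add mult_ac)
    qed fact
  next
    show "((\<lambda>s. (norm (a s) * (r ^ fst s * r ^ snd s)) * N) has_sum W * N) UNIV"
      by (rule has_sum_cmult_left[OF W])
    show "((\<lambda>s. (x ^ fst s * y ^ snd s) *\<^sub>R a s * h x y) has_sum g x y * h x y) UNIV"
      if "\<bar>x\<bar> \<le> r" "\<bar>y\<bar> \<le> r" for x y
      by (rule has_sum_cmult_left[OF g[OF that]])
  qed fact
  moreover have "0 \<le> N"
    using dseries_bound[OF assms(2), of 0 0] \<open>0 < r\<close> by (smt (verit) norm_ge_zero)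
  ultimately show ?thesis
    using \<open>W \<le> M\<close> by (elim dseries_mono) (rule mult_right_mono)
qed

lemma dseries_power:
  fixes g :: "real \<Rightarrow> real \<Rightarrow> complex"
  assumes "dseries r M g"
  shows "dseries r (M ^ k) (\<lambda>x y. g x y ^ k)"
proof (induction k)
  case 0
  from assms dseries_const[of r "1::complex"] show ?case by (simp add: dseries_def)
next
  case (Suc k)
  with dseries_mult[OF assms] show ?case by simp
qed

text \<open>The term \<open>f k * g ^ k\<close> has majorant bound
  \<open>norm (f k) * M ^ k\<close>. Since \<open>M\<close> also bounds the values of
  \<open>g\<close>, the expansion of \<open>H\<close> is used only on the closed disc of radius
  \<open>M\<close>.\<close>

lemma dseries_compose:
  fixes g :: "real \<Rightarrow> real \<Rightarrow> complex"
  assumes g: "dseries r M g" and f: "summable (\<lambda>k. norm (f k) * M ^ k)"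
    and H: "\<And>u. norm u \<le> M \<Longrightarrow> (\<lambda>k. f k * u ^ k) sums H u"
  shows "\<exists>N. dseries r N (\<lambda>x y. H (g x y))"
proof
  have "0 < r" using g by (simp add: dseries_def)
  have M0: "0 \<le> M" using dseries_bound[OF g, of 0 0] \<open>0 < r\<close> by (smt (verit) norm_ge_zero)
  show "dseries r (\<Sum>k. norm (f k) * M ^ k) (\<lambda>x y. H (g x y))"
  proof (rule dseries_has_sum[OF \<open>0 < r\<close>])
    show "dseries r (norm (f k) * M ^ k) (\<lambda>x y. f k * g x y ^ k)" for k
      by (intro dseries_mult dseries_const dseries_power \<open>0 < r\<close> g)
    show "((\<lambda>k. norm (f k) * M ^ k) has_sum (\<Sum>k. norm (f k) * M ^ k)) UNIV"
      using f M0 by (intro norm_summable_imp_has_sum summable_sums) (simp_all add: norm_mult)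
    fix x y :: real assume xy: "\<bar>x\<bar> \<le> r" "\<bar>y\<bar> \<le> r"
    have b: "norm (g x y) \<le> M" by (rule dseries_bound[OF g xy])
    show "((\<lambda>k. f k * g x y ^ k) has_sum H (g x y)) UNIV"
    proof (rule norm_summable_imp_has_sum[OF _ H[OF b]])
      show "summable (\<lambda>k. norm (f k * g x y ^ k))"
        by (rule summable_comparison_test'[OF f, of 0])
          (auto simp: norm_mult norm_power intro!: mult_left_mono power_mono b)
    qed
  qed
qed

text \<open>The form in which the closure rules are proved: it keeps some majorant on a closed
  square. \<open>real_analytic_onI\<close> afterwards drops the bound and restricts to the open
  square.\<close>

definition analytic_at2 :: "complex \<Rightarrow> (complex \<Rightarrow> 'e::banach) \<Rightarrow> bool" where
  "analytic_at2 z h \<longleftrightarrow> (\<exists>r M. dseries r M (\<lambda>x y. h (z + Complex x y)))"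

lemma analytic_at2_join:
  assumes "analytic_at2 z g" "analytic_at2 z h"
  obtains r M N where "dseries r M (\<lambda>x y. g (z + Complex x y))" "dseries r N (\<lambda>x y. h (z + Complex x y))"
proof -
  from assms obtain r M r' N where *: "dseries r M (\<lambda>x y. g (z + Complex x y))"
      "dseries r' N (\<lambda>x y. h (z + Complex x y))"
    unfolding analytic_at2_def by blast
  then have "0 < min r r'" by (simp add: dseries_def)
  with * show thesis by (intro that[of "min r r'" M N]) (auto elim!: dseries_shrink)
qed

lemma analytic_at2_add: "analytic_at2 z g \<Longrightarrow> analytic_at2 z h \<Longrightarrow> analytic_at2 z (\<lambda>w. g w + h w)"
  by (erule (1) analytic_at2_join) (unfold analytic_at2_def, intro exI, rule dseries_add)

lemma analytic_at2_mult:
  fixes g h :: "complex \<Rightarrow> complex"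
  shows "analytic_at2 z g \<Longrightarrow> analytic_at2 z h \<Longrightarrow> analytic_at2 z (\<lambda>w. g w * h w)"
  by (erule (1) analytic_at2_join) (unfold analytic_at2_def, intro exI, rule dseries_mult)

lemma analytic_at2_const: "analytic_at2 z (\<lambda>w. c)"
  unfolding analytic_at2_def using dseries_const[of 1 c] by auto

lemma analytic_at2_bounded_linear: "bounded_linear L \<Longrightarrow> analytic_at2 z g \<Longrightarrow> analytic_at2 z (\<lambda>w. L (g w))"
  unfolding analytic_at2_def using dseries_bounded_linear by blast

lemma analytic_at2_sum: "(\<And>i. i \<in> I \<Longrightarrow> analytic_at2 z (f i)) \<Longrightarrow> analytic_at2 z (\<lambda>x. \<Sum>i\<in>I. f i x)"
  by (induction I rule: infinite_finite_induct) (auto intro: analytic_at2_const analytic_at2_add)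

lemma Complex_eq_0: "Complex 0 0 = 0"
  by (simp add: complex_eq_iff)

text \<open>The function 1 - h / h(z) vanishes at \<open>z\<close>, so on a small square its
  majorant is at most 1/2 and the geometric series can be substituted.\<close>

lemma analytic_at2_inverse:
  fixes h :: "complex \<Rightarrow> complex"
  assumes "analytic_at2 z h" "h z \<noteq> 0"
  shows "analytic_at2 z (\<lambda>w. inverse (h w))"
proof -
  have "analytic_at2 z (\<lambda>w. 1 + (- inverse (h z)) * h w)"
    by (intro analytic_at2_add analytic_at2_const analytic_at2_mult assms)
  then obtain r M where g: "dseries r M (\<lambda>x y. 1 + (- inverse (h z)) * h (z + Complex x y))"
    unfolding analytic_at2_def by blast
  have "0 < r" using g by (simp add: dseries_def)
  \<comment> \<open>Shrinking multiplies the bound by \<open>r' / r\<close>, giving M / (2 (|M| +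
    1)), which is at most 1/2; the added 1 also ensures \<open>r' \<le> r\<close>.\<close>
  define r' where "r' = r / (2 * (\<bar>M\<bar> + 1))"
  have r': "0 < r'" "r' \<le> r" "r' / r * M \<le> 1 / 2"
  proof -
    show "0 < r'" "r' \<le> r" using \<open>0 < r\<close> by (auto simp: r'_def field_simps)
    have "r' / r * M = M / (2 * (\<bar>M\<bar> + 1))" using \<open>0 < r\<close> by (simp add: r'_def)
    also have "\<dots> \<le> 1 / 2" by (subst pos_divide_le_eq) auto
    finally show "r' / r * M \<le> 1 / 2" .
  qed
  have g': "dseries r' (1 / 2) (\<lambda>x y. 1 + (- inverse (h z)) * h (z + Complex x y))"
    by (rule dseries_mono[OF dseries_shrink_zero[OF g r'(1,2)] r'(3)])
      (simp add: Complex_eq_0 assms)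
  have "\<exists>N. dseries r' N (\<lambda>x y. inverse (1 - (1 + (- inverse (h z)) * h (z + Complex x y))))"
  proof (rule dseries_compose[OF g', where f = "\<lambda>_. 1"])
    show "(\<lambda>k. 1 * u ^ k) sums inverse (1 - u)" if "norm u \<le> 1 / 2" for u :: complex
      using geometric_sums[of u] that by (simp add: inverse_eq_divide)
  qed (use summable_geometric[of "1/2::real"] in simp)
  then have "analytic_at2 z (\<lambda>w. inverse (1 - (1 + (- inverse (h z)) * h w)))"
    unfolding analytic_at2_def by blast
  \<comment> \<open>The geometric series has produced h(z) / h, so the constant factor 1 / h(z)
    remains to be multiplied in.\<close>
  from analytic_at2_mult[OF analytic_at2_const[of z "inverse (h z)"] this] assms(2)
  show ?thesis by (simp flip: mult.assoc)
qed

text \<open>The displacement x + iy, as a series in two real variables, is substituted into the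
  Taylor series at \<open>z\<close>. On the square of half-width \<open>\<rho> / 4\<close> its
  majorant is \<open>\<rho> / 2\<close>, inside the disc of convergence.\<close>

lemma analytic_at2_holomorphic:
  assumes "open S" "h holomorphic_on S" "z \<in> S"
  shows "analytic_at2 z h"
proof -
  from assms obtain \<rho> where \<rho>: "0 < \<rho>" "ball z \<rho> \<subseteq> S" by (meson open_contains_ball)
  define f where "f = (\<lambda>n. (deriv ^^ n) h z / fact n)"
  have f: "(\<lambda>n. f n * u ^ n) sums h (z + u)" if "norm u < \<rho>" for u
    using holomorphic_power_series[OF holomorphic_on_subset[OF assms(2) \<rho>(2)], of "z + u"] that
    by (simp add: f_def dist_norm)
  have "\<exists>N. dseries (\<rho> / 4) N (\<lambda>x y. h (z + Complex x y))"
  proof (rule dseries_compose[where H = "\<lambda>u. h (z + u)" and f = f])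
    show "dseries (\<rho> / 4) (2 * (\<rho> / 4)) Complex"
      using \<rho>(1) by (intro dseries_Complex) simp
    show "(\<lambda>k. f k * u ^ k) sums h (z + u)" if "norm u \<le> 2 * (\<rho> / 4)" for u
      using that \<rho>(1) by (intro f) simp
    \<comment> \<open>Convergence at the radius \<open>3 * \<rho> / 4\<close>, strictly between
      \<open>\<rho> / 2\<close> and \<open>\<rho>\<close>, yields absolute convergence at
      \<open>\<rho> / 2\<close>.\<close>
    have "summable (\<lambda>n. f n * complex_of_real (3 * \<rho> / 4) ^ n)"
      using f[of "complex_of_real (3 * \<rho> / 4)"] \<rho>(1) sums_summable by (auto simp del: of_real_mult of_real_divide)
    from powser_insidea[OF this, of "complex_of_real (\<rho> / 2)"] \<rho>(1)
    show "summable (\<lambda>k. norm (f k) * (2 * (\<rho> / 4)) ^ k)"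
      by (simp add: norm_mult norm_power norm_divide)
  qed
  then show ?thesis by (auto simp: analytic_at2_def)
qed

lemma analytic_at2_local:
  assumes "open S" "z \<in> S" "\<And>w. w \<in> S \<Longrightarrow> g w = h w" "analytic_at2 z g"
  shows "analytic_at2 z h"
proof -
  from assms obtain \<rho> where \<rho>: "0 < \<rho>" "ball z \<rho> \<subseteq> S" by (meson open_contains_ball)
  from assms obtain r M where g: "dseries r M (\<lambda>x y. g (z + Complex x y))"
    unfolding analytic_at2_def by blast
  \<comment> \<open>With coordinates at most \<open>\<rho> / 3\<close> the displacement has modulus
    at most \<open>2 * \<rho> / 3\<close>, hence stays in the ball.\<close>
  define r' where "r' = min r (\<rho> / 3)"
  have r': "0 < r'" "r' \<le> r" "r' \<le> \<rho> / 3" using g \<rho> by (auto simp: r'_def dseries_def)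
  have "dseries r' M (\<lambda>x y. h (z + Complex x y))"
  proof (rule dseries_cong[OF dseries_shrink[OF g r'(1,2)]])
    fix x y :: real assume "\<bar>x\<bar> \<le> r'" "\<bar>y\<bar> \<le> r'"
    then have "norm (Complex x y) < \<rho>"
      using cmod_le[of "Complex x y"] r' \<rho> by simp
    then have "z + Complex x y \<in> ball z \<rho>" by (simp add: dist_norm)
    with \<rho>(2) assms(3) show "g (z + Complex x y) = h (z + Complex x y)" by blast
  qed
  then show ?thesis unfolding analytic_at2_def by blast
qed

lemma real_analytic_onI:
  assumes "\<And>z. z \<in> S \<Longrightarrow> analytic_at2 z h"
  shows "real_analytic_on S h"
  unfolding real_analytic_on_def
proof
  fix z assume "z \<in> S"
  with assms obtain r M where "dseries r M (\<lambda>x y. h (z + Complex x y))"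
    unfolding analytic_at2_def by blast
  then obtain a where "0 < r" and a: "\<And>x y. \<bar>x\<bar> \<le> r \<Longrightarrow> \<bar>y\<bar> \<le> r \<Longrightarrow>
      ((\<lambda>s. (x ^ fst s * y ^ snd s) *\<^sub>R a s) has_sum h (z + Complex x y)) UNIV"
    unfolding dseries_def by blast
  then show "\<exists>r>0. \<exists>a. \<forall>x y. \<bar>x\<bar> < r \<and> \<bar>y\<bar> < r \<longrightarrow>
      ((\<lambda>(i, j). (x ^ i * y ^ j) *\<^sub>R a i j) has_sum h (z + Complex x y)) UNIV"
    by (intro exI[of _ r] conjI exI[of _ "\<lambda>i j. a (i, j)"]) (auto simp: case_prod_beta')
qed

section \<open>Null curves and their normal matrices\<close>

text \<open>Functions built from holomorphic ones by conjugation and field operations. Smoothness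
  and analyticity of the normal both follow by induction over this one syntactic class.\<close>

inductive hol_generated :: "complex set \<Rightarrow> (complex \<Rightarrow> complex) \<Rightarrow> bool" for S where
  holomorphic: "h holomorphic_on S \<Longrightarrow> hol_generated S h"
| cnj: "hol_generated S h \<Longrightarrow> hol_generated S (\<lambda>w. cnj (h w))"
| add: "hol_generated S g \<Longrightarrow> hol_generated S h \<Longrightarrow> hol_generated S (\<lambda>w. g w + h w)"
| mult: "hol_generated S g \<Longrightarrow> hol_generated S h \<Longrightarrow> hol_generated S (\<lambda>w. g w * h w)"
| inverse: "hol_generated S h \<Longrightarrow> (\<And>w. w \<in> S \<Longrightarrow> h w \<noteq> 0) \<Longrightarrow> hol_generated S (\<lambda>w. inverse (h w))"

lemma hol_generated_const: "hol_generated S (\<lambda>w. c)"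
  by (rule hol_generated.holomorphic) simp

lemma hol_generated_uminus: "hol_generated S h \<Longrightarrow> hol_generated S (\<lambda>w. - h w)"
  using hol_generated.mult[OF hol_generated_const[of S "-1"]] by simp

lemma hol_generated_smooth: "hol_generated S h \<Longrightarrow> open S \<Longrightarrow> smooth_on S h"
  by (induction rule: hol_generated.induct)
    (auto intro: smooth_on_holomorphic smooth_on_add smooth_on_inverse
      smooth_on_bilinear[OF bounded_bilinear_mult] smooth_on_bounded_linear[OF bounded_linear_cnj])

lemma hol_generated_analytic: "hol_generated S h \<Longrightarrow> open S \<Longrightarrow> z \<in> S \<Longrightarrow> analytic_at2 z h"
  by (induction rule: hol_generated.induct)
    (auto intro: analytic_at2_holomorphic analytic_at2_add analytic_at2_inverse analytic_at2_mult
      analytic_at2_bounded_linear[OF bounded_linear_cnj])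

definition hol_matrix :: "complex set \<Rightarrow> (complex \<Rightarrow> complex^2^2) \<Rightarrow> bool" where
  "hol_matrix S M \<longleftrightarrow> (\<forall>i j. hol_generated S (\<lambda>w. M w $ i $ j))"

lemma hol_matrix_mult: "hol_matrix S M \<Longrightarrow> hol_matrix S N \<Longrightarrow> hol_matrix S (\<lambda>w. M w ** N w)"
  by (auto simp: hol_matrix_def matrix_matrix_mult_def sum_2
      intro!: hol_generated.add hol_generated.mult)

lemma hol_matrix_add: "hol_matrix S M \<Longrightarrow> hol_matrix S N \<Longrightarrow> hol_matrix S (\<lambda>w. M w + N w)"
  by (auto simp: hol_matrix_def intro!: hol_generated.add)

lemma hol_matrix_ctranspose: "hol_matrix S M \<Longrightarrow> hol_matrix S (\<lambda>w. ctranspose (M w))"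
  by (auto simp: hol_matrix_def ctranspose_def intro!: hol_generated.cnj)

lemma hol_matrix_const: "hol_matrix S (\<lambda>w. M)"
  by (simp add: hol_matrix_def hol_generated_const)

text \<open>Inverse of \<open>herm\<close> on Hermitian matrices, extended by a real-linear formula
  to all matrices. Linearity carries smoothness, analyticity and derivatives from the entries to the
  vector.\<close>

definition unherm :: "complex^2^2 \<Rightarrow> real^4" where
  "unherm X = (\<chi> i. if i = 0 then Re (X $ 1 $ 1 + X $ 2 $ 2) / 2 else if i = 1 then Re (X $ 1 $ 2)
               else if i = 2 then Im (X $ 1 $ 2) else Re (X $ 1 $ 1 - X $ 2 $ 2) / 2)"

lemma unherm_nth:
  "unherm X $ 0 = Re (X $ 1 $ 1 + X $ 2 $ 2) / 2" "unherm X $ 1 = Re (X $ 1 $ 2)"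
  "unherm X $ 2 = Im (X $ 1 $ 2)" "unherm X $ 3 = Re (X $ 1 $ 1 - X $ 2 $ 2) / 2"
  by (simp_all add: unherm_def)

lemma vec4_eqI: "x $ 0 = y $ 0 \<Longrightarrow> x $ 1 = y $ 1 \<Longrightarrow> x $ 2 = y $ 2 \<Longrightarrow> x $ 3 = y $ 3 \<Longrightarrow> x = y"
  for x y :: "'b^4"
  unfolding vec_eq_iff using index_4 by metis

lemma all_index_4: "P 0 \<Longrightarrow> P 1 \<Longrightarrow> P 2 \<Longrightarrow> P 3 \<Longrightarrow> P i" for i :: 4
  using index_4[of i] by blast

lemma unherm_herm: "unherm (herm x) = x"
  by (rule vec4_eqI) (simp_all add: unherm_nth herm_def)

lemma herm_unherm: "ctranspose X = X \<Longrightarrow> herm (unherm X) = X"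
  using hermitian_iff unherm_herm by metis

lemma hol_matrix_smooth_unherm:
  assumes "open S" "hol_matrix S M"
  shows "smooth_on S (\<lambda>w. unherm (M w))"
proof (rule smooth_on_vec[OF \<open>open S\<close>])
  have e: "smooth_on S (\<lambda>w. M w $ i $ j)" for i j
    using assms by (auto simp: hol_matrix_def intro: hol_generated_smooth)
  have l: "bounded_linear (\<lambda>u. Re u / 2)" "bounded_linear (\<lambda>u. - u :: complex)"
    by (intro bounded_linear_divide[THEN bounded_linear_compose] bounded_linear_Re
        bounded_linear_minus bounded_linear_ident)+
  show "smooth_on S (\<lambda>w. unherm (M w) $ i)" for i
  proof (rule all_index_4[of _ i])
    show "smooth_on S (\<lambda>w. unherm (M w) $ 0)"
      unfolding unherm_nth
      by (intro smooth_on_bounded_linear[OF l(1)] smooth_on_add e \<open>open S\<close>)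
    show "smooth_on S (\<lambda>w. unherm (M w) $ 3)"
      unfolding unherm_nth diff_conv_add_uminus
      by (intro smooth_on_bounded_linear[OF l(1)] smooth_on_bounded_linear[OF l(2)] smooth_on_add e \<open>open S\<close>)
    show "smooth_on S (\<lambda>w. unherm (M w) $ 1)" "smooth_on S (\<lambda>w. unherm (M w) $ 2)"
      unfolding unherm_nth
      by (intro smooth_on_bounded_linear[OF bounded_linear_Re] smooth_on_bounded_linear[OF bounded_linear_Im]
          e \<open>open S\<close>)+
  qed
qed

lemma hol_matrix_analytic_unherm:
  assumes "open S" "hol_matrix S M" "z \<in> S"
  shows "analytic_at2 z (\<lambda>w. unherm (M w))"
proof -
  have e: "analytic_at2 z (\<lambda>w. M w $ i $ j)" for i j
    using assms by (auto simp: hol_matrix_def intro: hol_generated_analytic)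
  have l: "bounded_linear (\<lambda>u. Re u / 2)" "bounded_linear (\<lambda>u. - u :: complex)"
    by (intro bounded_linear_divide[THEN bounded_linear_compose] bounded_linear_Re
        bounded_linear_minus bounded_linear_ident)+
  have c: "analytic_at2 z (\<lambda>w. unherm (M w) $ i)" for i
  proof (rule all_index_4[of _ i])
    show "analytic_at2 z (\<lambda>w. unherm (M w) $ 0)"
      unfolding unherm_nth
      by (intro analytic_at2_bounded_linear[OF l(1)] analytic_at2_add e)
    show "analytic_at2 z (\<lambda>w. unherm (M w) $ 3)"
      unfolding unherm_nth diff_conv_add_uminus
      by (intro analytic_at2_bounded_linear[OF l(1)] analytic_at2_bounded_linear[OF l(2)] analytic_at2_add e)
    show "analytic_at2 z (\<lambda>w. unherm (M w) $ 1)" "analytic_at2 z (\<lambda>w. unherm (M w) $ 2)"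
      unfolding unherm_nth
      by (intro analytic_at2_bounded_linear[OF bounded_linear_Re] analytic_at2_bounded_linear[OF bounded_linear_Im] e)+
  qed
  have "analytic_at2 z (\<lambda>w. \<Sum>i\<in>UNIV. axis i (unherm (M w) $ i))"
    by (intro analytic_at2_sum analytic_at2_bounded_linear[OF bounded_linear_axis] c)
  then show "analytic_at2 z (\<lambda>w. unherm (M w))"
    by (simp add: sum_axis)
qed

lemma has_derivative_unherm:
  assumes "\<And>i j. ((\<lambda>w. M w $ i $ j) has_derivative (\<lambda>v. M' v $ i $ j)) F"
  shows "((\<lambda>w. unherm (M w)) has_derivative (\<lambda>v. unherm (M' v))) F"
proof -
  have "((\<lambda>w. unherm (M w) $ i) has_derivative (\<lambda>v. unherm (M' v) $ i)) F" for i
  proof (rule all_index_4[of _ i])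
    have l: "bounded_linear (\<lambda>u. Re u / 2)"
      by (intro bounded_linear_divide[THEN bounded_linear_compose] bounded_linear_Re)
    show "((\<lambda>w. unherm (M w) $ 0) has_derivative (\<lambda>v. unherm (M' v) $ 0)) F"
      "((\<lambda>w. unherm (M w) $ 3) has_derivative (\<lambda>v. unherm (M' v) $ 3)) F"
      unfolding unherm_nth
      by (intro bounded_linear.has_derivative[OF l] has_derivative_add has_derivative_diff assms)+
    show "((\<lambda>w. unherm (M w) $ 1) has_derivative (\<lambda>v. unherm (M' v) $ 1)) F"
      "((\<lambda>w. unherm (M w) $ 2) has_derivative (\<lambda>v. unherm (M' v) $ 2)) F"
      unfolding unherm_nth
      by (intro bounded_linear.has_derivative[OF bounded_linear_Re]
          bounded_linear.has_derivative[OF bounded_linear_Im] assms)+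
  qed
  then have "((\<lambda>w. \<Sum>i\<in>UNIV. axis i (unherm (M w) $ i)) has_derivative
      (\<lambda>v. \<Sum>i\<in>UNIV. axis i (unherm (M' v) $ i))) F"
    by (intro has_derivative_sum bounded_linear.has_derivative[OF bounded_linear_axis])
  then show ?thesis by (simp add: sum_axis)
qed

section \<open>Algebra of two by two complex matrices and the polarized determinant\<close>

lemma matrix_mult_nth_2: "(A ** B) $ i $ j = A $ i $ 1 * B $ 1 $ j + A $ i $ 2 * B $ 2 $ j"
  for A B :: "complex^2^2"
  by (simp add: matrix_matrix_mult_def sum_2)

lemma ctranspose_nth: "ctranspose X $ i $ j = cnj (X $ j $ i)"
  by (simp add: ctranspose_def)

lemma e3_nth: "e3 $ 1 $ 1 = 1" "e3 $ 1 $ 2 = 0" "e3 $ 2 $ 1 = 0" "e3 $ 2 $ 2 = -1"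
  by (simp_all add: e3_def)

lemma matrix_eq_2: "A = B \<longleftrightarrow> A $ 1 $ 1 = B $ 1 $ 1 \<and> A $ 1 $ 2 = B $ 1 $ 2 \<and> A $ 2 $ 1 = B $ 2 $ 1 \<and> A $ 2 $ 2 = B $ 2 $ 2"
  for A B :: "complex^2^2"
  by (auto simp: vec_eq_iff forall_2)

lemma matrix_mult_add_rdistrib: "(A + B) ** C = A ** C + B ** C" for A B C :: "complex^2^2"
  by (simp add: matrix_eq_2 matrix_mult_nth_2 algebra_simps)

lemmas entries_2 = matrix_mult_nth_2 ctranspose_nth e3_nth matrix_eq_2 det_2

lemma ctranspose_mult: "ctranspose (A ** B) = ctranspose B ** ctranspose A" for A B :: "complex^2^2"
  by (simp add: entries_2 algebra_simps)

lemma ctranspose_add: "ctranspose (A + B) = ctranspose A + ctranspose B" for A B :: "complex^2^2"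
  by (simp add: entries_2)

lemma ctranspose_ctranspose: "ctranspose (ctranspose A) = A" for A :: "complex^2^2"
  by (simp add: entries_2)

lemma ctranspose_e3: "ctranspose e3 = e3"
  by (simp add: entries_2)

definition cscale :: "complex \<Rightarrow> complex^2^2 \<Rightarrow> complex^2^2" where
  "cscale c X = (\<chi> i j. c * X $ i $ j)"

text \<open>The symmetric bilinear form belonging to the quadratic form \<open>det\<close>; on
  Hermitian matrices it is -2 times the Lorentz product. Being complex bilinear, it can be evaluated
  on the non-Hermitian half F' e3 F^* of the derivative of the surface.\<close>

definition polar_det :: "complex^2^2 \<Rightarrow> complex^2^2 \<Rightarrow> complex" where
  "polar_det X Y = det (X + Y) - det X - det Y"

lemma polar_det_mult:
  "polar_det (F ** X ** G) (F ** Y ** G) = det F * det G * polar_det X Y"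
proof -
  have "F ** X ** G + F ** Y ** G = F ** (X + Y) ** G"
    by (simp add: matrix_add_ldistrib matrix_mult_add_rdistrib)
  then show ?thesis by (simp add: polar_det_def det_mul algebra_simps)
qed

lemma polar_det_add_right: "polar_det X (Y + Z) = polar_det X Y + polar_det X Z"
  by (simp add: polar_det_def det_2 algebra_simps)

lemma polar_det_cscale_right: "polar_det X (cscale c Y) = c * polar_det X Y"
  by (simp add: polar_det_def det_2 cscale_def algebra_simps)

lemma polar_det_ctranspose: "polar_det (ctranspose X) (ctranspose Y) = cnj (polar_det X Y)"
  by (simp add: polar_det_def det_2 ctranspose_def algebra_simps)

lemma polar_det_herm: "polar_det (herm x) (herm y) = - 2 * complex_of_real (lorentz x y)"
  by (simp add: polar_det_def det_2 herm_def lorentz_def complex_eq_iff algebra_simps)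

lemma lorentz_unherm_eq_0:
  assumes "ctranspose X = X" "ctranspose Y = Y" "polar_det X Y = 0"
  shows "lorentz (unherm X) (unherm Y) = 0"
  using polar_det_herm[of "unherm X" "unherm Y"] assms by (simp add: herm_unherm)

text \<open>For determinant 1 the adjugate is the inverse, and its entries are those of the matrix
  up to sign, which keeps it within \<open>hol_matrix\<close>.\<close>

definition adj2 :: "complex^2^2 \<Rightarrow> complex^2^2" where
  "adj2 X = vector [vector [X $ 2 $ 2, - X $ 1 $ 2], vector [- X $ 2 $ 1, X $ 1 $ 1]]"

lemma adj2_nth: "adj2 X $ 1 $ 1 = X $ 2 $ 2" "adj2 X $ 1 $ 2 = - X $ 1 $ 2"
  "adj2 X $ 2 $ 1 = - X $ 2 $ 1" "adj2 X $ 2 $ 2 = X $ 1 $ 1"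
  by (simp_all add: adj2_def)

lemma mult_adj2: "det X = 1 \<Longrightarrow> X ** adj2 X = mat 1"
  by (simp add: entries_2 adj2_nth mat_def algebra_simps)

lemma hol_matrix_adj2: "hol_matrix S M \<Longrightarrow> hol_matrix S (\<lambda>w. adj2 (M w))"
  by (auto simp: hol_matrix_def adj2_nth forall_2 intro!: hol_generated_uminus)

text \<open>With \<open>A = F\<^sup>-\<^sup>1 D\<close>, trace free and of determinant 0, the matrix below is \<open>F n F\<^sup>*\<close> for
  \<open>n = A A\<^sup>* + e3 A\<^sup>* A e3\<close>. For \<open>A = (g, -g\<^sup>2; 1, -g)\<close> this \<open>n\<close> is a positive
  multiple of \<open>(1 + \<bar>g\<bar>\<^sup>2, 2 g; 2 g\<^sup>*, 1 + \<bar>g\<bar>\<^sup>2)\<close>.\<close>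

definition normal_matrix :: "complex^2^2 \<Rightarrow> complex^2^2 \<Rightarrow> complex^2^2" where
  "normal_matrix F D = D ** ctranspose D +
     F ** e3 ** ctranspose (adj2 F ** D) ** ctranspose (F ** e3 ** ctranspose (adj2 F ** D))"

lemma ctranspose_normal_matrix: "ctranspose (normal_matrix F D) = normal_matrix F D"
  unfolding normal_matrix_def ctranspose_add
  by (simp only: ctranspose_mult[of "D"] ctranspose_ctranspose
      ctranspose_mult[of _ "ctranspose (F ** e3 ** ctranspose (adj2 F ** D))"])

text \<open>The time coordinate is half the trace, and the trace of \<open>X ** ctranspose X\<close>
  is the sum of the squared moduli of the entries. The summand with \<open>X = D\<close> is already
  positive.\<close>

lemma trace_normal_matrix_pos:
  assumes "D \<noteq> 0"
  shows "0 < unherm (normal_matrix F D) $ 0"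
proof -
  have *: "Re ((X ** ctranspose X) $ 1 $ 1 + (X ** ctranspose X) $ 2 $ 2) =
      (norm (X $ 1 $ 1))\<^sup>2 + (norm (X $ 1 $ 2))\<^sup>2 + (norm (X $ 2 $ 1))\<^sup>2 + (norm (X $ 2 $ 2))\<^sup>2" for X :: "complex^2^2"
    unfolding matrix_mult_nth_2 ctranspose_nth by (simp add: cmod_power2) (simp add: power2_eq_square)
  have "0 < (norm (D $ 1 $ 1))\<^sup>2 + (norm (D $ 1 $ 2))\<^sup>2 + (norm (D $ 2 $ 1))\<^sup>2 + (norm (D $ 2 $ 2))\<^sup>2"
  proof -
    from assms consider "D $ 1 $ 1 \<noteq> 0" | "D $ 1 $ 2 \<noteq> 0" | "D $ 2 $ 1 \<noteq> 0" | "D $ 2 $ 2 \<noteq> 0"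
      by (auto simp: matrix_eq_2)
    then show ?thesis
      by cases (simp_all add: add_pos_nonneg add_nonneg_pos)
  qed
  then have "0 < Re ((D ** ctranspose D) $ 1 $ 1 + (D ** ctranspose D) $ 2 $ 2)"
    by (simp only: *)
  moreover have "0 \<le> Re ((X ** ctranspose X) $ 1 $ 1 + (X ** ctranspose X) $ 2 $ 2)" for X :: "complex^2^2"
    unfolding * by simp
  moreover have "0 < a + b \<Longrightarrow> 0 \<le> c + d \<Longrightarrow> 0 < (a + c + (b + d)) / 2" for a b c d :: real
    by (subst half_gt_zero_iff) (metis add.assoc add.left_commute add_pos_nonneg)
  ultimately show ?thesis
    unfolding unherm_nth normal_matrix_def vector_add_component plus_complex.sel by blast
qed

text \<open>Against \<open>e3\<close> the two summands of \<open>n\<close> give opposite values,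
  because the diagonal entries of \<open>A\<close> have equal modulus. Against
  \<open>A ** e3\<close> each summand vanishes separately: with \<open>A\<close> = (a, b; c, -a)
  each gives 2 conj(a) (a^2 + bc), and a^2 + bc = - det A.\<close>

lemma polar_det_traceless_null:
  fixes A :: "complex^2^2"
  assumes tr: "A $ 1 $ 1 + A $ 2 $ 2 = 0" and det: "det A = 0"
  defines "n \<equiv> A ** ctranspose A + e3 ** ctranspose A ** A ** e3"
  shows "polar_det n e3 = 0" "polar_det n (A ** e3) = 0"
proof -
  have d: "A $ 2 $ 2 = - A $ 1 $ 1" using tr by algebra
  have q: "A $ 1 $ 1 * A $ 1 $ 1 = - (A $ 1 $ 2 * A $ 2 $ 1)"
    using det unfolding det_2 d by algebra
  \<comment> \<open>The algebraic normalization treats entries and their conjugates as independent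
    indeterminates, so the conjugate of the determinant relation is a separate hypothesis.\<close>
  then have q': "cnj (A $ 1 $ 1) * cnj (A $ 1 $ 1) = - (cnj (A $ 1 $ 2) * cnj (A $ 2 $ 1))"
    by (metis complex_cnj_minus complex_cnj_mult)
  show "polar_det n e3 = 0"
    unfolding n_def polar_det_def entries_2 vector_add_component d complex_cnj_minus by algebra
  show "polar_det n (A ** e3) = 0"
    using q q' unfolding n_def polar_det_def entries_2 vector_add_component d complex_cnj_minus by algebra
qed

text \<open>All matrices here have the shape F X F^*, and congruence by \<open>F\<close> of
  determinant 1 preserves the polarized determinant; this reduces the claim to the case where
  \<open>F\<close> is the identity.\<close>

lemma polar_det_normal_matrix:
  assumes F: "det F = 1" and D: "det D = 0"
    and tr: "(adj2 F ** D) $ 1 $ 1 + (adj2 F ** D) $ 2 $ 2 = 0"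
  shows "polar_det (normal_matrix F D) (F ** e3 ** ctranspose F) = 0"
    and "polar_det (normal_matrix F D) (D ** e3 ** ctranspose F) = 0"
proof -
  define A where "A = adj2 F ** D"
  have DA: "D = F ** A"
    by (simp add: A_def matrix_mul_assoc mult_adj2[OF F])
  have det: "det A = 0" by (simp add: A_def det_mul D)
  have N: "normal_matrix F D = F ** (A ** ctranspose A + e3 ** ctranspose A ** A ** e3) ** ctranspose F"
    unfolding normal_matrix_def A_def[symmetric]
    by (simp add: DA ctranspose_mult ctranspose_ctranspose ctranspose_e3 matrix_mul_assoc
        matrix_add_ldistrib matrix_mult_add_rdistrib)
  have D': "D ** e3 ** ctranspose F = F ** (A ** e3) ** ctranspose F"
    by (simp add: DA matrix_mul_assoc)
  note * = polar_det_traceless_null[OF tr[folded A_def] det]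
  show "polar_det (normal_matrix F D) (F ** e3 ** ctranspose F) = 0"
    unfolding N polar_det_mult *(1) by simp
  show "polar_det (normal_matrix F D) (D ** e3 ** ctranspose F) = 0"
    unfolding N D' polar_det_mult *(2) by simp
qed

section \<open>The normal field of a local representation\<close>

lemma bounded_bilinear_lorentz: "bounded_bilinear lorentz"
proof -
  have "bilinear lorentz"
    unfolding bilinear_def lorentz_def
    by (intro conjI allI linearI) (simp_all add: algebra_simps)
  then show ?thesis by (simp add: bilinear_conv_bounded_bilinear)
qed

lemma lorentz_commute: "lorentz x y = lorentz y x"
  by (simp add: lorentz_def mult.commute)

lemmas lorentz_simps =
  bounded_bilinear.add_left[OF bounded_bilinear_lorentz]
  bounded_bilinear.add_right[OF bounded_bilinear_lorentz]
  bounded_bilinear.diff_left[OF bounded_bilinear_lorentz]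
  bounded_bilinear.diff_right[OF bounded_bilinear_lorentz]
  bounded_bilinear.scaleR_left[OF bounded_bilinear_lorentz]
  bounded_bilinear.scaleR_right[OF bounded_bilinear_lorentz]
  bounded_bilinear.zero_left[OF bounded_bilinear_lorentz]
  bounded_bilinear.zero_right[OF bounded_bilinear_lorentz]

definition time_reflect :: "real^4 \<Rightarrow> real^4" where
  "time_reflect x = (\<chi> i. if i = 0 then - (x $ 0) else x $ i)"

lemma lorentz_conv_inner: "lorentz x y = time_reflect x \<bullet> y"
proof -
  have "(4::4) = 0" by simp
  then show ?thesis
    unfolding inner_vec_def sum_4 \<open>(4::4) = 0\<close> by (simp add: lorentz_def time_reflect_def)
qed

lemma linear_time_reflect: "linear time_reflect"
  by (rule linearI) (simp_all add: time_reflect_def vec_eq_iff)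

lemma time_reflect_eq_0: "time_reflect x = 0 \<longleftrightarrow> x = 0"
  by (auto simp: time_reflect_def vec_eq_iff split: if_splits)

text \<open>Time reflection maps the Euclidean complement onto the Lorentz complement. The dimension
  count therefore holds even for subspaces that meet their own complement.\<close>

lemma dim_lorentz_complement:
  assumes "subspace S"
  shows "dim {x. \<forall>s\<in>S. lorentz x s = 0} + dim S = 4"
proof -
  let ?P = "{y. \<forall>s\<in>S. orthogonal s y}"
  have "dim {y \<in> UNIV. \<forall>s\<in>S. orthogonal s y} + dim S = dim (UNIV :: (real^4) set)"
    by (rule dim_subspace_orthogonal_to_vectors) (use assms in auto)
  then have "dim ?P + dim S = 4" by simp
  have inv: "time_reflect (time_reflect x) = x" for x
    by (simp add: time_reflect_def vec_eq_iff)
  have "{x. \<forall>s\<in>S. lorentz x s = 0} = time_reflect ` ?P"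
  proof
    show "{x. \<forall>s\<in>S. lorentz x s = 0} \<subseteq> time_reflect ` ?P"
    proof
      fix x assume "x \<in> {x. \<forall>s\<in>S. lorentz x s = 0}"
      then have "time_reflect x \<in> ?P"
        by (simp add: lorentz_conv_inner orthogonal_def inner_commute)
      then show "x \<in> time_reflect ` ?P" by (rule rev_image_eqI) (simp add: inv)
    qed
  qed (auto simp: lorentz_conv_inner orthogonal_def inner_commute inv)
  moreover have "dim (time_reflect ` ?P) = dim ?P"
    by (rule dim_image_eq[OF linear_time_reflect]) (rule inj_on_inverseI[of _ time_reflect], rule inv)
  ultimately show ?thesis using \<open>dim ?P + dim S = 4\<close> by simp
qed

text \<open>The position vector and an injective differential span a space of dimension 3, whose
  Lorentz complement is a line. On a line the time component 1 singles out at most one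
  vector.\<close>

lemma normal_unique:
  fixes d :: "real^2 \<Rightarrow> real^4"
  assumes d: "linear d" "inj d" and q: "lorentz q q = 1" "\<And>v. lorentz (d v) q = 0"
    and x: "lorentz x q = 0" "\<And>v. lorentz x (d v) = 0" "x $ 0 = 1"
    and y: "lorentz y q = 0" "\<And>v. lorentz y (d v) = 0" "y $ 0 = 1"
  shows "x = y"
proof (rule ccontr)
  assume "x \<noteq> y"
  define S where "S = span (insert q (range d))"
  have span: "span (range d) = range d"
    using linear_subspace_image[OF d(1) subspace_UNIV] by simp
  \<comment> \<open>Elements of \<open>range d\<close> are orthogonal to \<open>q\<close>, but
    \<open>q\<close> is not orthogonal to itself.\<close>
  have "q \<notin> span (range d)"
    unfolding span using q by fastforce
  moreover have "dim (range d) = 2"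
    using dim_image_eq[OF d(1), of UNIV] d(2) by simp
  ultimately have "dim S = 3" by (simp add: S_def dim_insert)
  with dim_lorentz_complement[of S] have dim: "dim {u. \<forall>s\<in>S. lorentz u s = 0} = 1"
    by (simp add: S_def)
  have comp: "u \<in> {u. \<forall>s\<in>S. lorentz u s = 0}" if "lorentz u q = 0" "\<And>v. lorentz u (d v) = 0" for u
  proof -
    have "subspace {s. lorentz u s = 0}"
      by (simp add: subspace_def lorentz_simps)
    then have "S \<subseteq> {s. lorentz u s = 0}"
      unfolding S_def by (rule span_minimal[rotated]) (use that in auto)
    then show ?thesis by auto
  qed
  \<comment> \<open>The difference has time component 0 and \<open>x\<close> has time component 1,
    so a nonzero difference cannot be a multiple of \<open>x\<close>.\<close>
  have "independent {x - y, x}"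
  proof (rule independent_insertI)
    show "x - y \<notin> span {x}"
    proof
      assume "x - y \<in> span {x}"
      then obtain c where c: "x - y = c *\<^sub>R x" by (auto simp: span_singleton)
      then have "(x - y) $ 0 = (c *\<^sub>R x) $ 0" by simp
      with x(3) y(3) have "c = 0" by simp
      with c \<open>x \<noteq> y\<close> show False by simp
    qed
    show "independent {x}" using x(3) by (auto simp: dependent_single)
  qed
  then have "card {x - y, x} \<le> dim {u. \<forall>s\<in>S. lorentz u s = 0}"
    by (intro independent_card_le_dim) (use x y comp in \<open>auto simp: lorentz_simps\<close>)
  moreover have "x - y \<noteq> x" using y(3) by auto
  ultimately show False using dim by simp
qed

lemma lorentz_S31_derivative:
  assumes "open S" "x \<in> S" "\<And>y. y \<in> S \<Longrightarrow> g y \<in> S31" "(g has_derivative g') (at x)"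
  shows "lorentz (g' v) (g x) = 0"
proof -
  have "((\<lambda>y. lorentz (g y) (g y)) has_derivative (\<lambda>v. lorentz (g x) (g' v) + lorentz (g' v) (g x))) (at x)"
    by (rule bounded_bilinear.FDERIV[OF bounded_bilinear_lorentz assms(4) assms(4)])
  moreover have "((\<lambda>y. lorentz (g y) (g y)) has_derivative (\<lambda>v. 0)) (at x)"
    by (rule has_derivative_transform_within_open[OF has_derivative_const[of 1] assms(1,2)])
      (use assms(3) in \<open>simp add: S31_eq\<close>)
  ultimately have "(\<lambda>v. lorentz (g x) (g' v) + lorentz (g' v) (g x)) = (\<lambda>v. 0)"
    by (rule has_derivative_unique)
  then have "lorentz (g x) (g' v) + lorentz (g' v) (g x) = 0"
    by (rule fun_cong)
  then show ?thesis by (simp add: lorentz_commute)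
qed

section \<open>Charts and changes of coordinates\<close>

lemma is_chart_inv: "is_chart U \<phi> \<Longrightarrow> p \<in> U \<Longrightarrow> inv_into U \<phi> (\<phi> p) = p"
  unfolding is_chart_def by (meson homeomorphism_apply1)

lemma is_chart_open_image:
  assumes "is_chart U \<phi>" "open T" "T \<subseteq> U"
  shows "open (\<phi> ` T)"
proof -
  have "continuous_on (\<phi> ` U) (inv_into U \<phi>)" "open (\<phi> ` U)"
    using assms(1) by (auto simp: is_chart_def homeomorphism_def)
  then have "open (\<phi> ` U \<inter> inv_into U \<phi> -` T)"
    using assms(2) by (intro continuous_open_preimage)
  also have "\<phi> ` U \<inter> inv_into U \<phi> -` T = \<phi> ` T"
    using assms(3) by (auto simp: is_chart_inv[OF assms(1)] subset_iff intro: rev_image_eqI)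
  finally show ?thesis .
qed

lemma is_chart_continuous: "is_chart U \<phi> \<Longrightarrow> continuous_on U \<phi>"
  by (simp add: is_chart_def homeomorphism_def)

lemma is_chart_open: "is_chart U \<phi> \<Longrightarrow> open U" "is_chart U \<phi> \<Longrightarrow> open (\<phi> ` U)"
  by (simp_all add: is_chart_def)

lemma complex_structure_facts:
  assumes "complex_structure A U C" "(V, z) \<in> C"
  shows "is_chart V z" "V \<subseteq> U"
    and "(W, \<phi>) \<in> A \<Longrightarrow> smooth_on (\<phi> ` (W \<inter> V)) (z \<circ> inv_into W \<phi>)"
  using assms unfolding complex_structure_def by fastforce+

text \<open>Near \<open>p\<close> the map read in the real chart factors through the complex
  coordinate. Smoothness and orthogonality to the differential, both verified in \<open>z\<close>,
  thereby pass to the given atlas.\<close>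

lemma chart_change:
  assumes A: "smooth_atlas A" "(W, \<phi>) \<in> A" and C: "complex_structure A U C" "(V, z) \<in> C"
    and h: "smooth_on (z ` V) (h \<circ> inv_into V z)"
  shows "smooth_on (\<phi> ` (W \<inter> V)) (h \<circ> inv_into W \<phi>)"
    and "p \<in> W \<inter> V \<Longrightarrow> frechet_derivative (h \<circ> inv_into W \<phi>) (at (\<phi> p)) v =
      frechet_derivative (h \<circ> inv_into V z) (at (z p)) (frechet_derivative (z \<circ> inv_into W \<phi>) (at (\<phi> p)) v)"
proof -
  have W: "is_chart W \<phi>" using A unfolding smooth_atlas_def by blast
  note V = complex_structure_facts[OF C]
  have op: "open (\<phi> ` (W \<inter> V))"
    using W V(1) by (intro is_chart_open_image[OF W]) (auto simp: is_chart_open)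
  have im: "(z \<circ> inv_into W \<phi>) ` (\<phi> ` (W \<inter> V)) \<subseteq> z ` V"
    by (auto simp: is_chart_inv[OF W])
  have eq: "((h \<circ> inv_into V z) \<circ> (z \<circ> inv_into W \<phi>)) y = (h \<circ> inv_into W \<phi>) y"
    if "y \<in> \<phi> ` (W \<inter> V)" for y
    using that by (auto simp: is_chart_inv[OF W] is_chart_inv[OF V(1)])
  note z = V(3)[OF A(2)]
  show sm: "smooth_on (\<phi> ` (W \<inter> V)) (h \<circ> inv_into W \<phi>)"
    by (rule smooth_on_cong[OF op eq smooth_on_compose[OF op h z im]])
  assume p: "p \<in> W \<inter> V"
  then have p': "\<phi> p \<in> \<phi> ` (W \<inter> V)" by blast
  have zp: "(z \<circ> inv_into W \<phi>) (\<phi> p) = z p" using p by (simp add: is_chart_inv[OF W])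
  have "((h \<circ> inv_into V z) has_derivative frechet_derivative (h \<circ> inv_into V z) (at (z p)))
      (at ((z \<circ> inv_into W \<phi>) (\<phi> p)))"
    unfolding zp by (rule smooth_on_has_derivative[OF h]) (use p in blast)
  from diff_chain_at[OF smooth_on_has_derivative[OF z p'] this]
  have "(h \<circ> inv_into W \<phi> has_derivative
      frechet_derivative (h \<circ> inv_into V z) (at (z p)) \<circ> frechet_derivative (z \<circ> inv_into W \<phi>) (at (\<phi> p)))
      (at (\<phi> p))"
    by (rule has_derivative_transform_within_open[OF _ op p' eq])
  from frechet_derivative_eqI[OF this]
  show "frechet_derivative (h \<circ> inv_into W \<phi>) (at (\<phi> p)) v =
      frechet_derivative (h \<circ> inv_into V z) (at (z p)) (frechet_derivative (z \<circ> inv_into W \<phi>) (at (\<phi> p)) v)"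
    by simp
qed

text \<open>The normalization \<open>\<eta> $ 0 = 1\<close> removes the dependence on the coordinate and on the null lift.\<close>

definition local_normal :: "'a set \<Rightarrow> ('a \<Rightarrow> complex) \<Rightarrow> ('a \<Rightarrow> complex^2^2) \<Rightarrow> 'a \<Rightarrow> real^4" where
  "local_normal V z F p =
     (let x = unherm (normal_matrix (F p) (dFdz V z F p)) in (1 / x $ 0) *\<^sub>R x)"

lemma unherm_cscale_of_real: "unherm (cscale (complex_of_real c) X) = c *\<^sub>R unherm X"
  by (rule vec4_eqI) (simp_all add: unherm_nth cscale_def algebra_simps)

context
  fixes A :: "('a::topological_space set \<times> ('a \<Rightarrow> real^2)) set"
    and f :: "'a \<Rightarrow> real^4" and U C F V z
  assumes rep: "cmc1_representation A f U C F" and Vz: "(V, z) \<in> C"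
begin

lemma rep_cs: "complex_structure A U C"
  using rep by (simp add: cmc1_representation_def)

lemma rep_chart: "is_chart V z" "V \<subseteq> U"
  using complex_structure_facts[OF rep_cs Vz] by auto

lemma rep_facts:
  assumes "p \<in> V"
  shows "det (F p) = 1" "dFdz V z F p \<noteq> 0" "det (dFdz V z F p) = 0"
    "herm (f p) = F p ** e3 ** ctranspose (F p)"
  using rep Vz rep_chart assms
  unfolding cmc1_representation_def null_holomorphic_immersion_def by blast+

lemma rep_holomorphic: "(\<lambda>w. F (inv_into V z w) $ i $ j) holomorphic_on z ` V"
  using rep Vz unfolding cmc1_representation_def null_holomorphic_immersion_def by blast

lemma open_zV: "open (z ` V)"
  using rep_chart by (simp add: is_chart_open)

lemma dFdz_inv: "w \<in> z ` V \<Longrightarrow>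
    dFdz V z F (inv_into V z w) = (\<chi> i j. deriv (\<lambda>w. F (inv_into V z w) $ i $ j) w)"
  by (simp add: dFdz_def f_inv_into_f)

lemma rep_has_field_derivative: "w \<in> z ` V \<Longrightarrow>
    ((\<lambda>w. F (inv_into V z w) $ i $ j) has_field_derivative dFdz V z F (inv_into V z w) $ i $ j) (at w)"
  using holomorphic_derivI[OF rep_holomorphic open_zV] by (simp add: dFdz_inv)

text \<open>By Jacobi's formula this trace is the derivative of det F, which is constantly
  1.\<close>

lemma rep_traceless:
  assumes "p \<in> V"
  shows "(adj2 (F p) ** dFdz V z F p) $ 1 $ 1 + (adj2 (F p) ** dFdz V z F p) $ 2 $ 2 = 0"
proof -
  define w where "w = z p"
  have w: "w \<in> z ` V" and p: "p = inv_into V z w"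
    using assms rep_chart by (auto simp: w_def is_chart_inv)
  let ?F = "\<lambda>w. F (inv_into V z w)" and ?D = "dFdz V z F p"
  note D = rep_has_field_derivative[OF w, folded p]
  have "((\<lambda>w. ?F w $ 1 $ 1 * ?F w $ 2 $ 2 - ?F w $ 1 $ 2 * ?F w $ 2 $ 1) has_field_derivative
      (?D $ 1 $ 1 * F p $ 2 $ 2 + ?D $ 2 $ 2 * F p $ 1 $ 1) - (?D $ 1 $ 2 * F p $ 2 $ 1 + ?D $ 2 $ 1 * F p $ 1 $ 2)) (at w)"
    using DERIV_diff[OF DERIV_mult[OF D[of 1 1] D[of 2 2]] DERIV_mult[OF D[of 1 2] D[of 2 1]]]
    by (simp add: p[symmetric])
  moreover have "((\<lambda>w. ?F w $ 1 $ 1 * ?F w $ 2 $ 2 - ?F w $ 1 $ 2 * ?F w $ 2 $ 1) has_field_derivative 0) (at w)"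
  proof (rule has_field_derivative_transform_within_open[OF DERIV_const[of 1] open_zV w])
    fix u assume "u \<in> z ` V"
    then have "inv_into V z u \<in> V" by (rule inv_into_into)
    from rep_facts(1)[OF this]
    show "1 = ?F u $ 1 $ 1 * ?F u $ 2 $ 2 - ?F u $ 1 $ 2 * ?F u $ 2 $ 1" by (simp add: det_2)
  qed
  ultimately have "(?D $ 1 $ 1 * F p $ 2 $ 2 + ?D $ 2 $ 2 * F p $ 1 $ 1) -
      (?D $ 1 $ 2 * F p $ 2 $ 1 + ?D $ 2 $ 1 * F p $ 1 $ 2) = 0"
    by (rule DERIV_unique)
  then show ?thesis
    by (simp add: matrix_mult_nth_2 adj2_nth algebra_simps)
qed

lemma rep_hol_matrix:
  "hol_matrix (z ` V) (\<lambda>w. F (inv_into V z w))"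
  "hol_matrix (z ` V) (\<lambda>w. \<chi> i j. deriv (\<lambda>w. F (inv_into V z w) $ i $ j) w)"
  by (auto simp: hol_matrix_def intro!: hol_generated.holomorphic rep_holomorphic holomorphic_deriv open_zV)

lemma rep_S31: "p \<in> V \<Longrightarrow> f p \<in> S31"
proof -
  assume p: "p \<in> V"
  have "cnj (det (F p)) = det (ctranspose (F p))" by (simp add: det_2 ctranspose_nth)
  then have "det (herm (f p)) = -1"
    by (simp add: rep_facts[OF p] det_mul) (simp add: det_2 e3_nth)
  then show ?thesis by (simp add: S31_def ctranspose_herm)
qed

lemma rep_f_eq: "w \<in> z ` V \<Longrightarrow>
    unherm (F (inv_into V z w) ** e3 ** ctranspose (F (inv_into V z w))) = (f \<circ> inv_into V z) w"
  using rep_facts(4)[OF inv_into_into] by (metis comp_apply unherm_herm)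

lemma rep_f_smooth: "smooth_on (z ` V) (f \<circ> inv_into V z)"
  by (rule smooth_on_cong[OF open_zV rep_f_eq])
    (auto intro!: hol_matrix_smooth_unherm open_zV hol_matrix_mult hol_matrix_ctranspose
      hol_matrix_const rep_hol_matrix)

text \<open>Product rule for F e3 F^*: the holomorphic factor contributes \<open>cscale v P\<close>,
  and the conjugate factor its adjoint because \<open>e3\<close> is Hermitian.\<close>

lemma rep_f_derivative:
  assumes "p \<in> V"
  defines "P \<equiv> dFdz V z F p ** e3 ** ctranspose (F p)"
  shows "frechet_derivative (f \<circ> inv_into V z) (at (z p)) =
    (\<lambda>v. unherm (cscale v P + ctranspose (cscale v P)))"
proof (rule frechet_derivative_eqI)
  define w where "w = z p"
  have w: "w \<in> z ` V" and p: "p = inv_into V z w"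
    using assms rep_chart by (auto simp: w_def is_chart_inv)
  note D = rep_has_field_derivative[OF w, folded p, unfolded has_field_derivative_def]
  note cD = bounded_linear.has_derivative[OF bounded_linear_cnj D]
  let ?F = "\<lambda>w. F (inv_into V z w)"
  have "((\<lambda>w. unherm (?F w ** e3 ** ctranspose (?F w))) has_derivative
      (\<lambda>v. unherm (cscale v P + ctranspose (cscale v P)))) (at w)"
  proof (rule has_derivative_unherm)
    fix i j :: 2
    have "((\<lambda>w. ?F w $ i $ 1 * cnj (?F w $ j $ 1) - ?F w $ i $ 2 * cnj (?F w $ j $ 2)) has_derivative
      (\<lambda>v. (?F w $ i $ 1 * cnj (dFdz V z F p $ j $ 1 * v) + dFdz V z F p $ i $ 1 * v * cnj (?F w $ j $ 1)) -
        (?F w $ i $ 2 * cnj (dFdz V z F p $ j $ 2 * v) + dFdz V z F p $ i $ 2 * v * cnj (?F w $ j $ 2)))) (at w)"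
      by (intro has_derivative_diff has_derivative_mult D cD)
    then show "((\<lambda>w. (?F w ** e3 ** ctranspose (?F w)) $ i $ j) has_derivative
        (\<lambda>v. (cscale v P + ctranspose (cscale v P)) $ i $ j)) (at w)"
      by (simp add: P_def matrix_mult_nth_2 ctranspose_nth e3_nth cscale_def p[symmetric] algebra_simps)
  qed
  then show "(f \<circ> inv_into V z has_derivative (\<lambda>v. unherm (cscale v P + ctranspose (cscale v P)))) (at (z p))"
    unfolding w_def[symmetric]
    by (rule has_derivative_transform_within_open[OF _ open_zV w rep_f_eq])
qed

text \<open>Orthogonality to \<open>P\<close> extends to complex multiples of \<open>P\<close>.
  Since the normal matrix is Hermitian it extends to their adjoints, hence to every value of the
  differential.\<close>

lemma rep_local_normal:
  assumes p: "p \<in> V"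
  shows "local_normal V z F p $ 0 = 1" "lorentz (local_normal V z F p) (f p) = 0"
    "lorentz (local_normal V z F p) (frechet_derivative (f \<circ> inv_into V z) (at (z p)) v) = 0"
proof -
  let ?N = "normal_matrix (F p) (dFdz V z F p)"
  note facts = rep_facts[OF p]
  have "0 < unherm ?N $ 0"
    by (rule trace_normal_matrix_pos[OF facts(2)])
  then show "local_normal V z F p $ 0 = 1"
    by (simp add: local_normal_def Let_def)
  note polar = polar_det_normal_matrix[OF facts(1,3) rep_traceless[OF p]]
  have "lorentz (unherm ?N) (unherm (herm (f p))) = 0"
    by (rule lorentz_unherm_eq_0[OF ctranspose_normal_matrix ctranspose_herm])
      (simp add: facts(4) polar)
  then show "lorentz (local_normal V z F p) (f p) = 0"
    by (simp add: local_normal_def Let_def lorentz_simps unherm_herm)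
  define Q where "Q = cscale v (dFdz V z F p ** e3 ** ctranspose (F p))"
  have Q: "polar_det ?N Q = 0" by (simp add: Q_def polar_det_cscale_right polar)
  have "polar_det ?N (ctranspose Q) = 0"
    using polar_det_ctranspose[of ?N Q] Q by (simp add: ctranspose_normal_matrix)
  with Q have "lorentz (unherm ?N) (unherm (Q + ctranspose Q)) = 0"
    by (intro lorentz_unherm_eq_0 ctranspose_normal_matrix)
      (simp_all add: ctranspose_add ctranspose_ctranspose add.commute polar_det_add_right)
  then show "lorentz (local_normal V z F p) (frechet_derivative (f \<circ> inv_into V z) (at (z p)) v) = 0"
    by (simp add: rep_f_derivative[OF p] Q_def local_normal_def Let_def lorentz_simps)
qed

text \<open>The normalization divides by a real coordinate; written as twice the inverse of the
  complex trace, it stays within the class generated by holomorphic functions.\<close>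

lemma local_normal_hol_matrix:
  obtains M where "hol_matrix (z ` V) M"
    "\<And>w. w \<in> z ` V \<Longrightarrow> unherm (M w) = (local_normal V z F \<circ> inv_into V z) w"
proof -
  define N where "N = (\<lambda>w. normal_matrix (F (inv_into V z w)) (\<chi> i j. deriv (\<lambda>w. F (inv_into V z w) $ i $ j) w))"
  have N: "hol_matrix (z ` V) N"
    unfolding N_def normal_matrix_def
    by (intro hol_matrix_add hol_matrix_mult hol_matrix_ctranspose hol_matrix_const hol_matrix_adj2 rep_hol_matrix)
  have tr: "N w $ 1 $ 1 + N w $ 2 $ 2 = complex_of_real (2 * unherm (N w) $ 0)" for w
  proof -
    have "ctranspose (N w) = N w" by (simp add: N_def ctranspose_normal_matrix)
    then have "Im (N w $ 1 $ 1) = 0" "Im (N w $ 2 $ 2) = 0"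
      by (auto simp: matrix_eq_2 ctranspose_nth complex_eq_iff)
    then show ?thesis by (simp add: unherm_nth complex_eq_iff)
  qed
  have Nw: "N w = normal_matrix (F (inv_into V z w)) (dFdz V z F (inv_into V z w))" if "w \<in> z ` V" for w
    using that by (simp add: N_def dFdz_inv)
  have pos: "0 < unherm (N w) $ 0" if "w \<in> z ` V" for w
    unfolding Nw[OF that] by (rule trace_normal_matrix_pos) (rule rep_facts(2)[OF inv_into_into[OF that]])
  show thesis
  proof
    show "hol_matrix (z ` V) (\<lambda>w. cscale (2 * inverse (N w $ 1 $ 1 + N w $ 2 $ 2)) (N w))"
      unfolding hol_matrix_def cscale_def vec_lambda_beta
    proof (intro allI hol_generated.mult hol_generated.inverse hol_generated.add hol_generated_const)
      show "N w $ 1 $ 1 + N w $ 2 $ 2 \<noteq> 0" if "w \<in> z ` V" for w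
        using pos[OF that] unfolding tr by simp
    qed (use N in \<open>simp_all add: hol_matrix_def\<close>)
    fix w assume w: "w \<in> z ` V"
    have "2 * inverse (N w $ 1 $ 1 + N w $ 2 $ 2) = complex_of_real (1 / unherm (N w) $ 0)"
      unfolding tr by (simp add: field_simps)
    then show "unherm (cscale (2 * inverse (N w $ 1 $ 1 + N w $ 2 $ 2)) (N w)) =
        (local_normal V z F \<circ> inv_into V z) w"
      by (simp only: unherm_cscale_of_real) (simp add: local_normal_def Let_def Nw[OF w])
  qed
qed

lemma local_normal_smooth: "smooth_on (z ` V) (local_normal V z F \<circ> inv_into V z)"
proof -
  obtain M where M: "hol_matrix (z ` V) M"
    "\<And>w. w \<in> z ` V \<Longrightarrow> unherm (M w) = (local_normal V z F \<circ> inv_into V z) w"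
    by (rule local_normal_hol_matrix) (rule that)
  show ?thesis
    by (rule smooth_on_cong[OF open_zV M(2) hol_matrix_smooth_unherm[OF open_zV M(1)]])
qed

lemma local_normal_analytic:
  assumes "w \<in> z ` V"
  shows "analytic_at2 w (local_normal V z F \<circ> inv_into V z)"
proof -
  obtain M where M: "hol_matrix (z ` V) M"
    "\<And>w. w \<in> z ` V \<Longrightarrow> unherm (M w) = (local_normal V z F \<circ> inv_into V z) w"
    by (rule local_normal_hol_matrix) (rule that)
  show ?thesis
    by (rule analytic_at2_local[OF open_zV assms M(2) hol_matrix_analytic_unherm[OF open_zV M(1) assms]])
qed

lemma local_normal_continuous: "continuous_on V (local_normal V z F)"
proof -
  have "continuous_on V ((local_normal V z F \<circ> inv_into V z) \<circ> z)"
    by (intro continuous_on_compose is_chart_continuous[OF rep_chart(1)]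
        smooth_on_continuous[OF local_normal_smooth])
  then show ?thesis
    by (rule continuous_on_eq) (simp add: is_chart_inv[OF rep_chart(1)])
qed

end

section \<open>The global normal field\<close>

context
  fixes A :: "('a::topological_space set \<times> ('a \<Rightarrow> real^2)) set"
    and f :: "'a \<Rightarrow> real^4"
  assumes atlas: "smooth_atlas A" and face: "cmc1_face A f"
begin

text \<open>At regular points both normals span the same line; regular points are dense.\<close>

lemma local_normal_agree:
  assumes rep: "cmc1_representation A f U C F" "(V, z) \<in> C"
    and rep': "cmc1_representation A f U' C' F'" "(V', z') \<in> C'"
    and p: "p \<in> V" "p \<in> V'"
  shows "local_normal V z F p = local_normal V' z' F' p"
proof (rule ccontr)
  assume neq: "local_normal V z F p \<noteq> local_normal V' z' F' p"
  define d where "d = (\<lambda>q. local_normal V z F q - local_normal V' z' F' q)"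
  \<comment> \<open>If the normals differed at \<open>p\<close>, continuity would make them differ
    on an open set, which contains a regular point \<open>q\<close>.\<close>
  have "continuous_on (V \<inter> V') d"
    unfolding d_def
    by (intro continuous_on_diff continuous_on_subset[OF local_normal_continuous[OF rep]]
        continuous_on_subset[OF local_normal_continuous[OF rep']]) auto
  then have "open (V \<inter> V' \<inter> d -` (- {0}))"
    using rep_chart[OF rep] rep_chart[OF rep']
    by (intro continuous_open_preimage) (auto simp: is_chart_open)
  moreover have "p \<in> V \<inter> V' \<inter> d -` (- {0})" using p neq by (simp add: d_def)
  moreover have "closure (regular_set A f) = UNIV" using face by (simp add: cmc1_face_def)
  ultimately obtain q where q: "q \<in> V" "q \<in> V'" "d q \<noteq> 0" and reg: "q \<in> regular_set A f"
    using open_Int_closure_eq_empty[of "V \<inter> V' \<inter> d -` (- {0})" "regular_set A f"] by auto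
  have "q \<in> (\<Union>(W, \<phi>)\<in>A. W)" using atlas by (simp add: smooth_atlas_def)
  then obtain W \<phi> where W: "(W, \<phi>) \<in> A" "q \<in> W" by blast
  define D where "D = frechet_derivative (f \<circ> inv_into W \<phi>) (at (\<phi> q))"
  note cs = chart_change[OF atlas W(1) rep_cs[OF rep] rep(2) rep_f_smooth[OF rep]]
    and cs' = chart_change[OF atlas W(1) rep_cs[OF rep'] rep'(2) rep_f_smooth[OF rep']]
  have D: "(f \<circ> inv_into W \<phi> has_derivative D) (at (\<phi> q))"
    unfolding D_def by (rule smooth_on_has_derivative[OF cs(1)]) (use q W in blast)
  have W': "is_chart W \<phi>" using atlas W unfolding smooth_atlas_def by blast
  note n = rep_local_normal[OF rep q(1)] and n' = rep_local_normal[OF rep' q(2)]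
  have "local_normal V z F q = local_normal V' z' F' q"
  proof (rule normal_unique)
    show "linear D" using D has_derivative_linear by blast
    show "inj D" using reg W by (auto simp: regular_set_def differential_def D_def)
    show "lorentz (f q) (f q) = 1" using rep_S31[OF rep q(1)] by (simp add: S31_eq)
    show "lorentz (local_normal V z F q) (D v) = 0" for v
      unfolding D_def using cs(2)[of q] n(3) q W by simp
    show "lorentz (local_normal V' z' F' q) (D v) = 0" for v
      unfolding D_def using cs'(2)[of q] n'(3) q W by simp
    show "lorentz (D v) (f q) = 0" for v
    proof -
      have "lorentz (D v) ((f \<circ> inv_into W \<phi>) (\<phi> q)) = 0"
      proof (rule lorentz_S31_derivative[OF _ _ _ D])
        show "open (\<phi> ` (W \<inter> V))"
          using W' rep_chart[OF rep] by (intro is_chart_open_image[OF W']) (auto simp: is_chart_open)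
        show "(f \<circ> inv_into W \<phi>) y \<in> S31" if "y \<in> \<phi> ` (W \<inter> V)" for y
          using that rep_S31[OF rep] by (auto simp: is_chart_inv[OF W'])
      qed (use q W in blast)
      then show ?thesis using W by (simp add: is_chart_inv[OF W'])
    qed
  qed (use n n' in auto)
  with q show False by (simp add: d_def)
qed

text \<open>A pointwise choice; \<open>local_normal_agree\<close> identifies it with every local
  normal available at \<open>p\<close>, so it inherits their regularity.\<close>

definition face_normal :: "'a \<Rightarrow> real^4" where
  "face_normal p = (SOME x. \<exists>U C F V z. cmc1_representation A f U C F \<and> (V, z) \<in> C \<and> p \<in> V \<and>
     x = local_normal V z F p)"

lemma face_normal_eq:
  assumes "cmc1_representation A f U C F" "(V, z) \<in> C" "p \<in> V"
  shows "face_normal p = local_normal V z F p"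
proof -
  have "\<exists>U C F V z. cmc1_representation A f U C F \<and> (V, z) \<in> C \<and> p \<in> V \<and>
     face_normal p = local_normal V z F p"
    unfolding face_normal_def by (rule someI_ex) (use assms in blast)
  with local_normal_agree assms show ?thesis by metis
qed

lemma face_representation:
  obtains U C F V z where "cmc1_representation A f U C F" "(V, z) \<in> C" "p \<in> V"
proof -
  obtain U C F where "p \<in> U" and rep: "cmc1_representation A f U C F"
    using face unfolding cmc1_face_def by blast
  then obtain V z where "(V, z) \<in> C" "p \<in> V"
    unfolding cmc1_representation_def complex_structure_def by blast
  with rep that show thesis by blast
qed

text \<open>The coordinate domains of the representations cover the surface, so smoothness in the
  given atlas can be tested in complex coordinates.\<close>

lemma smooth_on_chartI:
  assumes W: "(W, \<phi>) \<in> A"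
    and h: "\<And>U C F V z. cmc1_representation A f U C F \<Longrightarrow> (V, z) \<in> C \<Longrightarrow>
      smooth_on (z ` V) (h \<circ> inv_into V z)"
  shows "smooth_on (\<phi> ` W) (h \<circ> inv_into W \<phi>)"
proof (rule smooth_on_local)
  fix y assume "y \<in> \<phi> ` W"
  then obtain p where p: "p \<in> W" "y = \<phi> p" by blast
  obtain U C F V z where rep: "cmc1_representation A f U C F" "(V, z) \<in> C" "p \<in> V"
    by (rule face_representation)
  have W': "is_chart W \<phi>" using atlas W unfolding smooth_atlas_def by blast
  have "open (\<phi> ` (W \<inter> V))"
    using W' rep_chart[OF rep(1,2)] by (intro is_chart_open_image[OF W']) (auto simp: is_chart_open)
  moreover have "smooth_on (\<phi> ` (W \<inter> V)) (h \<circ> inv_into W \<phi>)"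
    by (rule chart_change(1)[OF atlas W rep_cs[OF rep(1,2)] rep(2) h[OF rep(1,2)]])
  ultimately show "\<exists>T. open T \<and> y \<in> T \<and> smooth_on T (h \<circ> inv_into W \<phi>)"
    using p rep(3) by blast
qed

lemma face_smooth: "(W, \<phi>) \<in> A \<Longrightarrow> smooth_on (\<phi> ` W) (f \<circ> inv_into W \<phi>)"
  by (erule smooth_on_chartI) (rule rep_f_smooth)

lemma face_normal_local:
  assumes rep: "cmc1_representation A f U C F" "(V, z) \<in> C" and w: "w \<in> z ` V"
  shows "(local_normal V z F \<circ> inv_into V z) w = (face_normal \<circ> inv_into V z) w"
  using face_normal_eq[OF rep inv_into_into[OF w]] by simp

lemma face_normal_smooth: "(W, \<phi>) \<in> A \<Longrightarrow> smooth_on (\<phi> ` W) (face_normal \<circ> inv_into W \<phi>)"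
proof (rule smooth_on_chartI)
  fix U C F V z assume rep: "cmc1_representation A f U C F" "(V, z) \<in> C"
  show "smooth_on (z ` V) (face_normal \<circ> inv_into V z)"
    by (rule smooth_on_cong[OF open_zV[OF rep] face_normal_local[OF rep] local_normal_smooth[OF rep]])
qed

text \<open>Whatever representation is prescribed, the global field equals on its charts the local
  normal of that same representation, so no comparison of complex structures enters.\<close>

lemma face_real_analytic_face_normal: "face_real_analytic A f face_normal"
  unfolding face_real_analytic_def
proof (intro allI impI ballI, clarify)
  fix U C F V z assume rep: "cmc1_representation A f U C F" "(V, z) \<in> C"
  show "real_analytic_on (z ` V) (face_normal \<circ> inv_into V z)"
  proof (rule real_analytic_onI)
    fix w assume w: "w \<in> z ` V"
    show "analytic_at2 w (face_normal \<circ> inv_into V z)"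
      by (rule analytic_at2_local[OF open_zV[OF rep] w face_normal_local[OF rep] local_normal_analytic[OF rep w]])
  qed
qed

lemma normal_vector_field_face_normal: "normal_vector_field A f face_normal"
  unfolding normal_vector_field_def
proof (intro conjI allI ballI, goal_cases)
  case (1 p)
  obtain U C F V z where rep: "cmc1_representation A f U C F" "(V, z) \<in> C" "p \<in> V"
    by (rule face_representation)
  have "local_normal V z F p \<noteq> 0"
    using rep_local_normal(1)[OF rep] by auto
  then show ?case by (simp add: face_normal_eq[OF rep])
next
  case (2 p)
  obtain U C F V z where rep: "cmc1_representation A f U C F" "(V, z) \<in> C" "p \<in> V"
    by (rule face_representation)
  then show ?case by (simp add: face_normal_eq[OF rep] tangent_S31_def rep_local_normal)
next
  case (3 W\<phi>)
  show ?case
  proof (cases W\<phi>, clarify)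
    fix W \<phi> p v assume eq: "W\<phi> = (W, \<phi>)" and p: "p \<in> W"
    obtain U C F V z where rep: "cmc1_representation A f U C F" "(V, z) \<in> C" "p \<in> V"
      by (rule face_representation)
    have W: "(W, \<phi>) \<in> A" using 3 eq by simp
    show "lorentz (face_normal p) (differential (W, \<phi>) f p v) = 0"
      using chart_change(2)[OF atlas W rep_cs[OF rep(1,2)] rep(2) rep_f_smooth[OF rep(1,2)], of p v]
        p rep(3) rep_local_normal(3)[OF rep]
      by (simp add: differential_def face_normal_eq[OF rep])
  qed
qed

lemma face_in_S31: "f p \<in> S31"
  by (rule face_representation[of p]) (rule rep_S31)

end

section \<open>The frontal lift\<close>

lemma smooth_mapI:
  assumes "\<And>p. \<exists>U \<phi> D \<kappa> W. (U, \<phi>) \<in> A \<and> (D, \<kappa>) \<in> B \<and> open W \<and> p \<in> W \<and> W \<subseteq> U \<and> F ` W \<subseteq> D \<and>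
    smooth_on (\<phi> ` W) (\<kappa> \<circ> F \<circ> inv_into U \<phi>)"
  shows "smooth_map A B F"
  unfolding smooth_map_def
proof
  fix p
  obtain U \<phi> D \<kappa> W where *: "(U, \<phi>) \<in> A" "(D, \<kappa>) \<in> B" "open W" "p \<in> W" "W \<subseteq> U" "F ` W \<subseteq> D"
    "smooth_on (\<phi> ` W) (\<kappa> \<circ> F \<circ> inv_into U \<phi>)"
    using assms[of p] by (elim exE conjE) (rule that)
  show "\<exists>(U, \<phi>)\<in>A. \<exists>(D, \<kappa>)\<in>B. \<exists>W. open W \<and> p \<in> W \<and> W \<subseteq> U \<and> F ` W \<subseteq> D \<and>
      smooth_on (\<phi> ` W) (\<kappa> \<circ> F \<circ> inv_into U \<phi>)"
    by (rule bexI[of _ "(U, \<phi>)"], unfold prod.case, rule bexI[of _ "(D, \<kappa>)"], unfold prod.case,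
        intro exI[of _ W] conjI) (rule *)+
qed

lemma S31_chart_facts:
  assumes "(U, \<psi>) \<in> S31_charts"
  shows "U \<subseteq> S31" "inj_on \<psi> U" "open (\<psi> ` U)" "smooth_on (\<psi> ` U) (inv_into U \<psi>)"
    and "\<exists>W. open W \<and> U = W \<inter> S31 \<and> smooth_on W \<psi>"
  using assms unfolding S31_charts_def by blast+

section \<open>Tangent and cotangent spaces of de Sitter space\<close>

lemma subspace_tangent_S31: "subspace (tangent_S31 q)"
  by (simp add: tangent_S31_def subspace_def lorentz_simps)

lemma dim_tangent_S31:
  assumes "q \<in> S31"
  shows "dim (tangent_S31 q) = 3"
proof -
  have "q \<noteq> 0" using assms by (auto simp: S31_eq lorentz_simps)
  moreover have "{x. \<forall>s\<in>span {q}. lorentz x s = 0} = tangent_S31 q"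
    by (auto simp: tangent_S31_def span_singleton lorentz_simps)
  ultimately show ?thesis
    using dim_lorentz_complement[of "span {q}"] by (simp add: dim_insert)
qed

text \<open>The time reflection of \<open>x\<close> pairs with \<open>x\<close> to the Euclidean
  square norm. Subtracting its component along \<open>q\<close> makes it tangent without changing
  the pairing, as \<open>x\<close> is orthogonal to \<open>q\<close>.\<close>

lemma lorentz_nondegenerate_tangent:
  assumes q: "q \<in> S31" and x: "x \<in> tangent_S31 q" "x \<noteq> 0"
  obtains v where "v \<in> tangent_S31 q" "lorentz x v \<noteq> 0"
proof -
  let ?w = "time_reflect x"
  define v where "v = ?w - lorentz ?w q *\<^sub>R q"
  have "v \<in> tangent_S31 q"
    using q by (simp add: v_def tangent_S31_def lorentz_simps S31_eq)
  moreover have "lorentz x v = ?w \<bullet> ?w"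
    using x by (simp add: v_def tangent_S31_def lorentz_simps lorentz_conv_inner[symmetric])
  ultimately show thesis using that x by (simp add: time_reflect_eq_0)
qed

text \<open>Differentiating the identity \<psi> o \<psi>^-1 makes \<open>J\<close> injective, and
  differentiating \<langle>q, q\<rangle> = 1 puts its range into the tangent space. Both have
  dimension 3, so they coincide.\<close>

lemma S31_chart_derivatives:
  assumes U: "(U, \<psi>) \<in> S31_charts" and q: "q \<in> U"
  defines "J \<equiv> frechet_derivative (inv_into U \<psi>) (at (\<psi> q))"
  shows "(inv_into U \<psi> has_derivative J) (at (\<psi> q))"
    and "(\<psi> has_derivative frechet_derivative \<psi> (at q)) (at q)"
    and "frechet_derivative \<psi> (at q) (J v) = v" and "range J = tangent_S31 q"
proof -
  note facts = S31_chart_facts[OF U]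
  obtain W where W: "open W" "U = W \<inter> S31" "smooth_on W \<psi>" using facts(5) by blast
  have \<psi>q: "\<psi> q \<in> \<psi> ` U" using q by blast
  have inv: "inv_into U \<psi> (\<psi> q) = q" using facts(2) q by simp
  show J: "(inv_into U \<psi> has_derivative J) (at (\<psi> q))"
    unfolding J_def by (rule smooth_on_has_derivative[OF facts(4) \<psi>q])
  show P: "(\<psi> has_derivative frechet_derivative \<psi> (at q)) (at q)"
    by (rule smooth_on_has_derivative[OF W(3)]) (use W q in blast)
  then have "(\<psi> has_derivative frechet_derivative \<psi> (at q)) (at (inv_into U \<psi> (\<psi> q)))"
    by (simp add: inv)
  from diff_chain_at[OF J this]
  have "((\<lambda>y. y) has_derivative frechet_derivative \<psi> (at q) \<circ> J) (at (\<psi> q))"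
    by (rule has_derivative_transform_within_open[OF _ facts(3) \<psi>q]) (simp add: f_inv_into_f)
  then have "frechet_derivative \<psi> (at q) \<circ> J = (\<lambda>v. v)"
    by (rule has_derivative_unique[OF _ has_derivative_ident])
  then have PJ: "frechet_derivative \<psi> (at q) (J v) = v" for v
    unfolding comp_def by (rule fun_cong)
  then show "frechet_derivative \<psi> (at q) (J v) = v" .
  have "linear J" using J has_derivative_linear by blast
  show "range J = tangent_S31 q"
  proof (rule subspace_dim_equal)
    show "subspace (range J)"
      using linear_subspace_image[OF \<open>linear J\<close> subspace_UNIV] .
    show "range J \<subseteq> tangent_S31 q"
    proof (clarify)
      fix v
      have "lorentz (J v) (inv_into U \<psi> (\<psi> q)) = 0"
        by (rule lorentz_S31_derivative[OF facts(3) \<psi>q subsetD[OF facts(1) inv_into_into] J])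
      then show "J v \<in> tangent_S31 q" by (simp add: inv tangent_S31_def)
    qed
    have "inj J" using PJ by (intro injI) metis
    then show "dim (tangent_S31 q) \<le> dim (range J)"
      using dim_image_eq[OF \<open>linear J\<close>, of UNIV] dim_tangent_S31[of q] facts(1) q by auto
  qed (rule subspace_tangent_S31)
qed

text \<open>The covector dual to \<open>x\<close> under the Lorentz metric, with value zero off the
  tangent space as \<open>cotangent_space\<close> demands.\<close>

definition flat_covector :: "real^4 \<Rightarrow> real^4 \<Rightarrow> real^4 \<Rightarrow> real" where
  "flat_covector q x v = (if v \<in> tangent_S31 q then lorentz x v else 0)"

lemma restrict_in_cotangent_space:
  assumes "linear g"
  shows "(\<lambda>v. if v \<in> tangent_S31 q then g v else 0) \<in> cotangent_space q"
  using subspace_tangent_S31[of q] assms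
  by (auto simp: cotangent_space_def subspace_def linear_add linear_scale)

lemma linear_lorentz: "linear (lorentz x)"
  using bounded_bilinear.bounded_linear_right[OF bounded_bilinear_lorentz] bounded_linear.linear by blast

lemma flat_covector_in_cotangent_space: "flat_covector q x \<in> cotangent_space q"
  using restrict_in_cotangent_space[OF linear_lorentz] unfolding flat_covector_def by blast

lemma coord_vector_tangent:
  assumes "(U, \<psi>) \<in> S31_charts" "q \<in> U"
  shows "coord_vector U \<psi> i q \<in> tangent_S31 q"
  using S31_chart_derivatives(4)[OF assms] unfolding coord_vector_def by blast

lemma flat_covector_coord:
  assumes "(U, \<psi>) \<in> S31_charts" "q \<in> U"
  shows "flat_covector q x (coord_vector U \<psi> i q) = lorentz x (coord_vector U \<psi> i q)"
  using coord_vector_tangent[OF assms] by (simp add: flat_covector_def)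

text \<open>The coordinate vectors span the tangent space, on which the Lorentz form is
  nondegenerate. This supplies a projective chart around each point of the lift.\<close>

lemma ex_coord_nonzero:
  assumes U: "(U, \<psi>) \<in> S31_charts" "q \<in> U" and x: "x \<in> tangent_S31 q" "x \<noteq> 0"
  shows "\<exists>j. lorentz x (coord_vector U \<psi> j q) \<noteq> 0"
proof (rule ccontr)
  assume *: "\<not> ?thesis"
  have "q \<in> S31" using S31_chart_facts(1)[OF U(1)] U(2) by blast
  from lorentz_nondegenerate_tangent[OF this x] obtain v
    where v: "v \<in> tangent_S31 q" "lorentz x v \<noteq> 0" .
  define J where "J = frechet_derivative (inv_into U \<psi>) (at (\<psi> q))"
  note J = S31_chart_derivatives[OF U, folded J_def]
  have lin: "linear (\<lambda>u. lorentz x (J u))"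
    using linear_compose[OF _ linear_lorentz] J(1) has_derivative_linear unfolding comp_def by blast
  obtain u where u: "v = J u" using J(4) v(1) by blast
  have "lorentz x (J u) = lorentz x (J (\<Sum>i\<in>UNIV. u $ i *\<^sub>R axis i 1))"
    using basis_expansion[of u] by (simp add: scalar_mult_eq_scaleR)
  also have "\<dots> = (\<Sum>i\<in>UNIV. u $ i * lorentz x (coord_vector U \<psi> i q))"
    by (simp only: linear_sum[OF lin] linear_scale[OF lin]) (simp add: coord_vector_def J_def)
  also have "\<dots> = 0" using * by simp
  finally show False using v u by simp
qed

lemma index_3_shift_neq: "j + 1 \<noteq> j" "j + 2 \<noteq> j" "j + 1 \<noteq> j + 2" "j \<noteq> j + 1" "j \<noteq> j + 2" "j + 2 \<noteq> j + 1"
  for j :: 3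
  by simp_all

text \<open>Domain and map of a single projective chart are named so that the index \<open>j\<close>
  and the underlying chart can be chosen explicitly.\<close>

definition proj_chart_dom where
  "proj_chart_dom U \<psi> j = {(q, l) \<in> proj_cotangent_bundle. q \<in> U \<and> (\<exists>\<alpha>\<in>l. \<alpha> (coord_vector U \<psi> j q) \<noteq> 0)}"

definition proj_chart :: "(real^4) set \<Rightarrow> (real^4 \<Rightarrow> real^3) \<Rightarrow> 3 \<Rightarrow>
    (real^4) \<times> (real^4 \<Rightarrow> real) set \<Rightarrow> (real^3) \<times> (real^2)" where
  "proj_chart U \<psi> j = (\<lambda>(q, l). (\<psi> q, let \<alpha> = (THE \<alpha>. \<alpha> \<in> l \<and> \<alpha> (coord_vector U \<psi> j q) = 1)
      in vector [\<alpha> (coord_vector U \<psi> (j + 1) q), \<alpha> (coord_vector U \<psi> (j + 2) q)]))"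

lemma proj_cotangent_charts_eq:
  "proj_cotangent_charts = {(proj_chart_dom U \<psi> j, proj_chart U \<psi> j) | U \<psi> j. (U, \<psi>) \<in> S31_charts}"
  unfolding proj_cotangent_charts_def proj_chart_dom_def proj_chart_def ..

lemma proj_chart_projectivize:
  assumes nz: "\<alpha> (coord_vector U \<psi> j q) \<noteq> 0"
  shows "proj_chart U \<psi> j (projectivize (q, \<alpha>)) =
    (\<psi> q, vector [\<alpha> (coord_vector U \<psi> (j + 1) q) / \<alpha> (coord_vector U \<psi> j q),
                  \<alpha> (coord_vector U \<psi> (j + 2) q) / \<alpha> (coord_vector U \<psi> j q)])"
proof -
  have "(THE \<beta>. \<beta> \<in> range (\<lambda>c v. c * \<alpha> v) \<and> \<beta> (coord_vector U \<psi> j q) = 1) =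
      (\<lambda>v. 1 / \<alpha> (coord_vector U \<psi> j q) * \<alpha> v)"
    using nz by (intro the_equality conjI rangeI) (auto simp: field_simps)
  then show ?thesis by (simp add: proj_chart_def projectivize_def)
qed

lemma projectivize_in_proj_chart_dom:
  assumes "q \<in> U" "U \<subseteq> S31" "\<alpha> \<in> cotangent_space q" and nz: "\<alpha> (coord_vector U \<psi> j q) \<noteq> 0"
  shows "projectivize (q, \<alpha>) \<in> proj_chart_dom U \<psi> j"
proof -
  have "\<alpha> \<in> range (\<lambda>c v. c * \<alpha> v)"
    by (rule range_eqI[of _ _ 1]) simp
  moreover have "\<alpha> \<noteq> (\<lambda>v. 0)" using nz by auto
  ultimately show ?thesis
    using assms unfolding proj_chart_dom_def proj_cotangent_bundle_def cotangent_bundle_def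
    by (auto simp: projectivize_def)
qed

lemma projectivize_in_proj_chart_domD:
  "projectivize (q, \<alpha>) \<in> proj_chart_dom U \<psi> j \<Longrightarrow> q \<in> U \<and> \<alpha> (coord_vector U \<psi> j q) \<noteq> 0"
  by (auto simp: proj_chart_dom_def projectivize_def)

text \<open>Since \<open>inv_into\<close> is arbitrary off the range, this needs that the chart maps onto \<open>\<psi> ` U \<times> UNIV\<close>:
  the line spanned by the functional \<open>\<beta>\<close> is a preimage of \<open>(u, t)\<close>.\<close>

lemma fst_inv_proj_chart:
  assumes U: "(U, \<psi>) \<in> S31_charts" and u: "u \<in> \<psi> ` U"
  shows "fst (inv_into (proj_chart_dom U \<psi> j) (proj_chart U \<psi> j) (u, t)) = inv_into U \<psi> u"
proof -
  note facts = S31_chart_facts[OF U]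
  obtain q where q: "q \<in> U" "u = \<psi> q" using u by blast
  define P where "P = frechet_derivative \<psi> (at q)"
  \<comment> \<open>In coordinate differentials this is d\<psi>_j + t_1 d\<psi>_(j+1) + t_2
    d\<psi>_(j+2): already normalized on the j-th coordinate vector, with \<open>t\<close> as its
    fibre coordinates.\<close>
  define g where "g = (\<lambda>v. P v $ j + t $ 1 * P v $ (j + 1) + t $ 2 * P v $ (j + 2))"
  define \<beta> where "\<beta> = (\<lambda>v. if v \<in> tangent_S31 q then g v else 0)"
  note d = S31_chart_derivatives[OF U q(1), folded P_def]
  have "linear P" using d(2) has_derivative_linear by blast
  then have "linear g"
    by (intro linearI) (simp_all add: g_def linear_add linear_scale algebra_simps)
  then have \<beta>: "\<beta> \<in> cotangent_space q" unfolding \<beta>_def by (rule restrict_in_cotangent_space)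
  have "\<beta> (coord_vector U \<psi> i q) = g (coord_vector U \<psi> i q)" for i
    by (simp add: \<beta>_def coord_vector_tangent[OF U q(1)])
  then have c: "\<beta> (coord_vector U \<psi> i q) = axis i 1 $ j + t $ 1 * axis i 1 $ (j + 1) + t $ 2 * axis i 1 $ (j + 2)" for i
    by (simp add: g_def coord_vector_def d(3))
  have c': "\<beta> (coord_vector U \<psi> j q) = 1" "\<beta> (coord_vector U \<psi> (j + 1) q) = t $ 1"
    "\<beta> (coord_vector U \<psi> (j + 2) q) = t $ 2"
    unfolding c by (simp_all add: axis_def index_3_shift_neq)
  have dom: "projectivize (q, \<beta>) \<in> proj_chart_dom U \<psi> j"
    by (rule projectivize_in_proj_chart_dom[OF q(1) facts(1) \<beta>]) (simp add: c')
  have "vector [t $ 1, t $ 2] = t" by (simp add: vec_eq_iff forall_2)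
  then have "proj_chart U \<psi> j (projectivize (q, \<beta>)) = (u, t)"
    by (subst proj_chart_projectivize) (simp_all add: c' q(2))
  with dom have im: "(u, t) \<in> proj_chart U \<psi> j ` proj_chart_dom U \<psi> j" by (metis imageI)
  define \<xi> where "\<xi> = inv_into (proj_chart_dom U \<psi> j) (proj_chart U \<psi> j) (u, t)"
  have "\<xi> \<in> proj_chart_dom U \<psi> j" "proj_chart U \<psi> j \<xi> = (u, t)"
    unfolding \<xi>_def using inv_into_into[OF im] f_inv_into_f[OF im] by auto
  then have "fst \<xi> \<in> U" "\<psi> (fst \<xi>) = u"
    by (auto simp: proj_chart_dom_def proj_chart_def split: prod.splits)
  then have "fst \<xi> = inv_into U \<psi> u" using facts(2) by auto
  then show ?thesis by (simp add: \<xi>_def)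
qed

context
  fixes A :: "('a::topological_space set \<times> ('a \<Rightarrow> real^2)) set"
    and f \<eta> :: "'a \<Rightarrow> real^4"
  assumes atlas: "smooth_atlas A" and f_map: "smooth_map A S31_charts f"
    and f_S31: "\<And>p. f p \<in> S31"
    and f_smooth: "\<And>W \<phi>. (W, \<phi>) \<in> A \<Longrightarrow> smooth_on (\<phi> ` W) (f \<circ> inv_into W \<phi>)"
    and \<eta>_smooth: "\<And>W \<phi>. (W, \<phi>) \<in> A \<Longrightarrow> smooth_on (\<phi> ` W) (\<eta> \<circ> inv_into W \<phi>)"
    and normal: "normal_vector_field A f \<eta>"
begin

definition normal_covector :: "'a \<Rightarrow> (real^4) \<times> (real^4 \<Rightarrow> real)" where
  "normal_covector p = (f p, flat_covector (f p) (\<eta> p))"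

lemma atlas_chart: "(W, \<phi>) \<in> A \<Longrightarrow> is_chart W \<phi>"
  using atlas unfolding smooth_atlas_def by blast

text \<open>\<open>Y\<close> is open because a chart domain is the trace on \<open>S31\<close> of an
  open set, and all values of \<open>f\<close> lie in \<open>S31\<close>. The last conclusion
  concerns the components of the covector dual to \<open>\<eta>\<close>.\<close>

lemma f_chart_domain:
  assumes W: "(W, \<phi>) \<in> A" and U: "(U, \<psi>) \<in> S31_charts"
  defines "Y \<equiv> {y \<in> \<phi> ` W. f (inv_into W \<phi> y) \<in> U}"
  shows "open Y" "smooth_on Y (\<psi> \<circ> (f \<circ> inv_into W \<phi>))"
    and "smooth_on Y (\<lambda>y. lorentz (\<eta> (inv_into W \<phi> y)) (coord_vector U \<psi> i (f (inv_into W \<phi> y))))"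
proof -
  note facts = S31_chart_facts[OF U]
  obtain T where T: "open T" "U = T \<inter> S31" "smooth_on T \<psi>" using facts(5) by blast
  have "Y = \<phi> ` W \<inter> (f \<circ> inv_into W \<phi>) -` T"
    using f_S31 by (auto simp: Y_def T(2))
  then show Y: "open Y"
    using continuous_open_preimage[OF smooth_on_continuous[OF f_smooth[OF W]] _ T(1)]
      is_chart_open(2)[OF atlas_chart[OF W]] by simp
  have sub: "Y \<subseteq> \<phi> ` W" by (auto simp: Y_def)
  show sm: "smooth_on Y (\<psi> \<circ> (f \<circ> inv_into W \<phi>))"
    by (rule smooth_on_compose[OF Y T(3) smooth_on_subset[OF f_smooth[OF W] sub]])
      (auto simp: Y_def T(2))
  have "smooth_on Y ((\<lambda>u. frechet_derivative (inv_into U \<psi>) (at u) (axis i 1)) \<circ> (\<psi> \<circ> (f \<circ> inv_into W \<phi>)))"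
    by (rule smooth_on_compose[OF Y smooth_on_frechet_derivative[OF facts(4)] sm]) (auto simp: Y_def)
  from smooth_on_bilinear[OF bounded_bilinear_lorentz Y smooth_on_subset[OF \<eta>_smooth[OF W] sub] this]
  show "smooth_on Y (\<lambda>y. lorentz (\<eta> (inv_into W \<phi> y)) (coord_vector U \<psi> i (f (inv_into W \<phi> y))))"
    by (simp add: coord_vector_def comp_def)
qed

lemma normal_covector_cotangent: "normal_covector p \<in> cotangent_bundle"
  by (simp add: normal_covector_def cotangent_bundle_def f_S31 flat_covector_in_cotangent_space)

lemma \<eta>_tangent: "\<eta> p \<in> tangent_S31 (f p)" "\<eta> p \<noteq> 0"
  using normal by (auto simp: normal_vector_field_def)

lemma charts_at:
  obtains W \<phi> U \<psi> where "(W, \<phi>) \<in> A" "(U, \<psi>) \<in> S31_charts" "p \<in> W" "f p \<in> U"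
proof -
  obtain c d T where "c \<in> A" "d \<in> S31_charts" "p \<in> T" "T \<subseteq> fst c" "f ` T \<subseteq> fst d"
    using f_map[unfolded smooth_map_def, rule_format, of p] by (auto simp: case_prod_beta)
  then have "(fst c, snd c) \<in> A" "(fst d, snd d) \<in> S31_charts" "p \<in> fst c" "f p \<in> fst d" by auto
  with that show thesis by blast
qed

lemma open_chart_preimage:
  assumes "(W, \<phi>) \<in> A" "open Y" "Y \<subseteq> \<phi> ` W"
  shows "open (W \<inter> \<phi> -` Y)" "\<phi> ` (W \<inter> \<phi> -` Y) = Y"
  using assms continuous_open_preimage[OF is_chart_continuous[OF atlas_chart[OF assms(1)]]]
    is_chart_open[OF atlas_chart[OF assms(1)]] by auto

lemma smooth_normal_covector: "smooth_map A cotangent_charts normal_covector"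
proof (rule smooth_mapI)
  fix p
  obtain W \<phi> U \<psi> where W: "(W, \<phi>) \<in> A" "p \<in> W" and U: "(U, \<psi>) \<in> S31_charts" "f p \<in> U"
    by (rule charts_at)
  define Y where "Y = {y \<in> \<phi> ` W. f (inv_into W \<phi> y) \<in> U}"
  note Y = f_chart_domain[OF W(1) U(1), folded Y_def]
  have sub: "Y \<subseteq> \<phi> ` W" by (auto simp: Y_def)
  note T = open_chart_preimage[OF W(1) Y(1) sub]
  note inv = is_chart_inv[OF atlas_chart[OF W(1)]]
  define \<kappa> :: "(real^4) \<times> (real^4 \<Rightarrow> real) \<Rightarrow> (real^3) \<times> (real^3)"
    where "\<kappa> = (\<lambda>(q, \<alpha>). (\<psi> q, \<chi> i. \<alpha> (coord_vector U \<psi> i q)))"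
  define D where "D = {(q, \<alpha>) \<in> cotangent_bundle. q \<in> U}"
  have "smooth_on Y (\<lambda>y. ((\<psi> \<circ> (f \<circ> inv_into W \<phi>)) y,
      \<chi> i. lorentz (\<eta> (inv_into W \<phi> y)) (coord_vector U \<psi> i (f (inv_into W \<phi> y)))))"
    by (rule smooth_on_Pair[OF Y(1,2) smooth_on_vec[OF Y(1)]]) (simp add: Y(3))
  then have sm: "smooth_on Y (\<kappa> \<circ> normal_covector \<circ> inv_into W \<phi>)"
    by (rule smooth_on_cong[OF Y(1), rotated])
      (auto simp: \<kappa>_def normal_covector_def Y_def flat_covector_coord[OF U(1)])
  have "p \<in> W \<inter> \<phi> -` Y" using W U by (simp add: Y_def inv)
  moreover have "normal_covector ` (W \<inter> \<phi> -` Y) \<subseteq> D"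
  proof
    fix \<xi> assume "\<xi> \<in> normal_covector ` (W \<inter> \<phi> -` Y)"
    then obtain r where r: "\<xi> = normal_covector r" "r \<in> W" "\<phi> r \<in> Y" by blast
    from r(3) have "f r \<in> U" unfolding Y_def by (simp add: inv r(2))
    then show "\<xi> \<in> D"
      using normal_covector_cotangent[of r] by (simp add: D_def r(1) normal_covector_def)
  qed
  moreover have "(D, \<kappa>) \<in> cotangent_charts"
    using U unfolding cotangent_charts_def D_def \<kappa>_def by blast
  moreover have "smooth_on (\<phi> ` (W \<inter> \<phi> -` Y)) (\<kappa> \<circ> normal_covector \<circ> inv_into W \<phi>)"
    unfolding T(2) by (rule sm)
  ultimately show "\<exists>W \<phi> D \<kappa> T. (W, \<phi>) \<in> A \<and> (D, \<kappa>) \<in> cotangent_charts \<and> open T \<and> p \<in> T \<and> T \<subseteq> W \<and>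
      normal_covector ` T \<subseteq> D \<and> smooth_on (\<phi> ` T) (\<kappa> \<circ> normal_covector \<circ> inv_into W \<phi>)"
    using W(1) T(1) by blast
qed

text \<open>The fibre coordinates are quotients of covector components by \<open>a j\<close>,
  nonzero on \<open>Y\<close>. The last conclusion identifies \<open>Y\<close> with the preimage of
  the projective chart domain, so that the contact condition can be treated in an arbitrary
  chart.\<close>

lemma proj_chart_domain:
  fixes j :: 3
  assumes W: "(W, \<phi>) \<in> A" and U: "(U, \<psi>) \<in> S31_charts"
  defines "a \<equiv> \<lambda>i y. lorentz (\<eta> (inv_into W \<phi> y)) (coord_vector U \<psi> i (f (inv_into W \<phi> y)))"
  defines "Y \<equiv> {y \<in> \<phi> ` W. f (inv_into W \<phi> y) \<in> U \<and> a j y \<noteq> 0}"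
  shows "open Y" "smooth_on Y (proj_chart U \<psi> j \<circ> (projectivize \<circ> normal_covector) \<circ> inv_into W \<phi>)"
    and "\<And>y. y \<in> Y \<Longrightarrow>
      fst ((proj_chart U \<psi> j \<circ> (projectivize \<circ> normal_covector) \<circ> inv_into W \<phi>) y) = \<psi> (f (inv_into W \<phi> y))"
    and "\<And>p. p \<in> W \<Longrightarrow> \<phi> p \<in> Y \<longleftrightarrow> projectivize (normal_covector p) \<in> proj_chart_dom U \<psi> j"
proof -
  define X where "X = {y \<in> \<phi> ` W. f (inv_into W \<phi> y) \<in> U}"
  note X = f_chart_domain[OF W U, folded X_def]
  have a: "smooth_on X (a i)" for i unfolding a_def by (rule X(3))
  have "Y = X \<inter> a j -` (- {0})" by (auto simp: Y_def X_def)
  then show Y: "open Y"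
    using continuous_open_preimage[OF smooth_on_continuous[OF a] X(1), of "- {0}" j] by auto
  have YX: "Y \<subseteq> X" by (auto simp: Y_def X_def)
  note sm = smooth_on_subset[OF _ YX]
  have eq: "(\<psi> (f (inv_into W \<phi> y)), vector [a (j + 1) y * inverse (a j y), a (j + 2) y * inverse (a j y)]) =
      (proj_chart U \<psi> j \<circ> (projectivize \<circ> normal_covector) \<circ> inv_into W \<phi>) y" if "y \<in> Y" for y
  proof -
    let ?p = "inv_into W \<phi> y"
    have p: "f ?p \<in> U" "a j y \<noteq> 0" using that by (auto simp: Y_def)
    have c: "flat_covector (f ?p) (\<eta> ?p) (coord_vector U \<psi> i (f ?p)) = a i y" for i
      by (simp add: flat_covector_coord[OF U p(1)] a_def)
    show ?thesis
      using proj_chart_projectivize[of "flat_covector (f ?p) (\<eta> ?p)" U \<psi> j "f ?p"] p(2)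
      by (simp add: c normal_covector_def divide_inverse)
  qed
  have "smooth_on Y (\<lambda>y. vector [a (j + 1) y * inverse (a j y), a (j + 2) y * inverse (a j y)] :: real^2)"
  proof (rule smooth_on_vec[OF Y])
    have *: "smooth_on Y (\<lambda>y. a i y * inverse (a j y))" for i
      by (intro smooth_on_bilinear[OF bounded_bilinear_mult] smooth_on_inverse Y sm a) (simp add: Y_def)
    show "smooth_on Y (\<lambda>y. (vector [a (j + 1) y * inverse (a j y), a (j + 2) y * inverse (a j y)] :: real^2) $ i)" for i
      using exhaust_2[of i] * by auto
  qed
  then have "smooth_on Y (\<lambda>y. (\<psi> (f (inv_into W \<phi> y)),
      vector [a (j + 1) y * inverse (a j y), a (j + 2) y * inverse (a j y)] :: real^2))"
    using sm[OF X(2)] by (intro smooth_on_Pair Y) (simp_all add: comp_def)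
  then show "smooth_on Y (proj_chart U \<psi> j \<circ> (projectivize \<circ> normal_covector) \<circ> inv_into W \<phi>)"
    by (rule smooth_on_cong[OF Y eq, rotated])
  show "fst ((proj_chart U \<psi> j \<circ> (projectivize \<circ> normal_covector) \<circ> inv_into W \<phi>) y) = \<psi> (f (inv_into W \<phi> y))"
    if "y \<in> Y" for y
    using arg_cong[OF eq[OF that], of fst] by simp
  fix p assume "p \<in> W"
  then have inv: "inv_into W \<phi> (\<phi> p) = p" by (rule is_chart_inv[OF atlas_chart[OF W]])
  show "\<phi> p \<in> Y \<longleftrightarrow> projectivize (normal_covector p) \<in> proj_chart_dom U \<psi> j"
  proof
    assume "\<phi> p \<in> Y"
    then show "projectivize (normal_covector p) \<in> proj_chart_dom U \<psi> j"
      unfolding normal_covector_def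
      by (intro projectivize_in_proj_chart_dom S31_chart_facts(1)[OF U] flat_covector_in_cotangent_space)
        (auto simp: Y_def inv a_def flat_covector_coord[OF U])
  next
    assume "projectivize (normal_covector p) \<in> proj_chart_dom U \<psi> j"
    from projectivize_in_proj_chart_domD[OF this[unfolded normal_covector_def]] \<open>p \<in> W\<close>
    show "\<phi> p \<in> Y" by (auto simp: Y_def inv a_def flat_covector_coord[OF U])
  qed
qed

lemma smooth_projectivize_normal_covector:
  "smooth_map A proj_cotangent_charts (projectivize \<circ> normal_covector)"
proof (rule smooth_mapI)
  fix p
  obtain W \<phi> U \<psi> where W: "(W, \<phi>) \<in> A" "p \<in> W" and U: "(U, \<psi>) \<in> S31_charts" "f p \<in> U"
    by (rule charts_at)
  obtain j where j: "lorentz (\<eta> p) (coord_vector U \<psi> j (f p)) \<noteq> 0"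
    using ex_coord_nonzero[OF U \<eta>_tangent] by blast
  define Y where "Y = {y \<in> \<phi> ` W. f (inv_into W \<phi> y) \<in> U \<and>
    lorentz (\<eta> (inv_into W \<phi> y)) (coord_vector U \<psi> j (f (inv_into W \<phi> y))) \<noteq> 0}"
  note Y = proj_chart_domain[OF W(1) U(1), where j = j, folded Y_def]
  have sub: "Y \<subseteq> \<phi> ` W" by (auto simp: Y_def)
  note T = open_chart_preimage[OF W(1) Y(1) sub]
  have "p \<in> W \<inter> \<phi> -` Y"
    using W U j by (simp add: Y_def is_chart_inv[OF atlas_chart[OF W(1)]])
  moreover have "(projectivize \<circ> normal_covector) ` (W \<inter> \<phi> -` Y) \<subseteq> proj_chart_dom U \<psi> j"
    using Y(4) by auto
  moreover have "(proj_chart_dom U \<psi> j, proj_chart U \<psi> j) \<in> proj_cotangent_charts"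
    using U unfolding proj_cotangent_charts_eq by blast
  moreover have "smooth_on (\<phi> ` (W \<inter> \<phi> -` Y))
      (proj_chart U \<psi> j \<circ> (projectivize \<circ> normal_covector) \<circ> inv_into W \<phi>)"
    unfolding T(2) by (rule Y(2))
  ultimately show "\<exists>W \<phi> D \<kappa> T. (W, \<phi>) \<in> A \<and> (D, \<kappa>) \<in> proj_cotangent_charts \<and> open T \<and> p \<in> T \<and> T \<subseteq> W \<and>
      (projectivize \<circ> normal_covector) ` T \<subseteq> D \<and>
      smooth_on (\<phi> ` T) (\<kappa> \<circ> (projectivize \<circ> normal_covector) \<circ> inv_into W \<phi>)"
    using W(1) T(1) by blast
qed

text \<open>The lift covers \<open>f\<close>, so projecting its differential to the base gives df,
  on which the covector dual to \<open>\<eta>\<close> vanishes. In charts the base component of the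
  lift is \<psi> o f, and \<open>J\<close> carries its derivative back to df.\<close>

lemma projectivize_normal_covector_contact:
  assumes W: "(W, \<phi>) \<in> A" "p \<in> W" and U: "(U, \<psi>) \<in> S31_charts"
    and dom: "projectivize (normal_covector p) \<in> proj_chart_dom U \<psi> j"
  shows "differential (W, \<phi>) (proj_chart U \<psi> j \<circ> (projectivize \<circ> normal_covector)) p v \<in>
    contact_hyperplane (proj_chart_dom U \<psi> j, proj_chart U \<psi> j) (projectivize (normal_covector p))"
proof -
  note facts = S31_chart_facts[OF U]
  define Y where "Y = {y \<in> \<phi> ` W. f (inv_into W \<phi> y) \<in> U \<and>
    lorentz (\<eta> (inv_into W \<phi> y)) (coord_vector U \<psi> j (f (inv_into W \<phi> y))) \<noteq> 0}"
  note Y = proj_chart_domain[OF W(1) U, where j = j, folded Y_def]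
  define G where "G = proj_chart U \<psi> j \<circ> (projectivize \<circ> normal_covector) \<circ> inv_into W \<phi>"
  define G' where "G' = frechet_derivative G (at (\<phi> p))"
  have y: "\<phi> p \<in> Y" using Y(4) W dom by blast
  have inv: "inv_into W \<phi> (\<phi> p) = p" using W by (simp add: is_chart_inv[OF atlas_chart])
  have q: "f p \<in> U" using y by (simp add: Y_def inv)
  define J where "J = frechet_derivative (inv_into U \<psi>) (at (\<psi> (f p)))"
  note J = S31_chart_derivatives(1)[OF U q, folded J_def]
  have G: "(G has_derivative G') (at (\<phi> p))"
    unfolding G'_def by (rule smooth_on_has_derivative[OF Y(2)[folded G_def] y])
  have fG: "fst (G y) = \<psi> (f (inv_into W \<phi> y))" if "y \<in> Y" for y
    unfolding G_def by (rule Y(3)[OF that])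
  have "(inv_into U \<psi> \<circ> (\<lambda>y. fst (G y)) has_derivative J \<circ> (\<lambda>v. fst (G' v))) (at (\<phi> p))"
    by (rule diff_chain_at[OF has_derivative_fst[OF G]]) (use J fG[OF y] in \<open>simp add: inv\<close>)
  then have "(f \<circ> inv_into W \<phi> has_derivative J \<circ> (\<lambda>v. fst (G' v))) (at (\<phi> p))"
  proof (rule has_derivative_transform_within_open[OF _ Y(1) y])
    fix y assume "y \<in> Y"
    then show "(inv_into U \<psi> \<circ> (\<lambda>y. fst (G y))) y = (f \<circ> inv_into W \<phi>) y"
      using facts(2) by (simp add: fG) (simp add: Y_def)
  qed
  then have df: "differential (W, \<phi>) f p v = J (fst (G' v))"
    by (simp add: differential_def frechet_derivative_eqI)
  let ?D = "proj_chart_dom U \<psi> j" and ?\<kappa> = "proj_chart U \<psi> j" and ?\<xi> = "projectivize (normal_covector p)"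
  have \<kappa>\<xi>: "?\<kappa> ?\<xi> = G (\<phi> p)" by (simp add: G_def inv)
  have G0: "fst (G (\<phi> p)) = \<psi> (f p)" using fG[OF y] by (simp add: inv)
  \<comment> \<open>The bundle projection read in the chart is \<psi>^-1 o fst on the open set
    \<psi>(U) x UNIV, so its derivative is that of \<psi>^-1 applied to the base component.\<close>
  have "(inv_into U \<psi> \<circ> fst has_derivative J \<circ> fst) (at (G (\<phi> p)))"
    by (rule diff_chain_at) (use J in \<open>auto simp: G0 intro: derivative_eq_intros\<close>)
  then have "(fst \<circ> inv_into ?D ?\<kappa> has_derivative J \<circ> fst) (at (G (\<phi> p)))"
  proof (rule has_derivative_transform_within_open)
    show "open (\<psi> ` U \<times> (UNIV :: (real^2) set))" by (intro open_Times facts(3) open_UNIV)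
    show "G (\<phi> p) \<in> \<psi> ` U \<times> UNIV" using G0 q by (auto simp: mem_Times_iff)
    show "(inv_into U \<psi> \<circ> fst) u = (fst \<circ> inv_into ?D ?\<kappa>) u" if "u \<in> \<psi> ` U \<times> UNIV" for u
      using that fst_inv_proj_chart[OF U, of "fst u" j "snd u"] by (auto simp: mem_Times_iff)
  qed
  then have "differential (?D, ?\<kappa>) fst ?\<xi> = J \<circ> fst"
    by (simp add: differential_def \<kappa>\<xi> frechet_derivative_eqI)
  moreover have "differential (W, \<phi>) (?\<kappa> \<circ> (projectivize \<circ> normal_covector)) p v = G' v"
    by (simp add: differential_def G'_def G_def)
  moreover have "lorentz (\<eta> p) (J (fst (G' v))) = 0"
  proof -
    have "\<forall>(W, \<phi>)\<in>A. \<forall>p\<in>W. \<forall>v. lorentz (\<eta> p) (differential (W, \<phi>) f p v) = 0"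
      using normal by (simp add: normal_vector_field_def)
    from bspec[OF this W(1)] W(2) have "lorentz (\<eta> p) (differential (W, \<phi>) f p v) = 0" by simp
    then show ?thesis by (simp only: df)
  qed
  ultimately show ?thesis
    by (auto simp: contact_hyperplane_def projectivize_def normal_covector_def flat_covector_def)
qed

text \<open>Nondegeneracy on the tangent space turns \<open>\<eta> p \<noteq> 0\<close> into a
  nonzero covector, so the line it spans is a point of the projectivized bundle.\<close>

lemma projectivize_normal_covector_bundle:
  "(projectivize \<circ> normal_covector) p \<in> proj_cotangent_bundle" "fst ((projectivize \<circ> normal_covector) p) = f p"
proof -
  obtain v where "v \<in> tangent_S31 (f p)" "lorentz (\<eta> p) v \<noteq> 0"
    using lorentz_nondegenerate_tangent[OF f_S31 \<eta>_tangent] .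
  then have "flat_covector (f p) (\<eta> p) v \<noteq> 0" by (simp add: flat_covector_def)
  then have "flat_covector (f p) (\<eta> p) \<noteq> (\<lambda>v. 0)" by metis
  with normal_covector_cotangent[of p] show "(projectivize \<circ> normal_covector) p \<in> proj_cotangent_bundle"
    unfolding proj_cotangent_bundle_def normal_covector_def by auto
qed (simp add: projectivize_def normal_covector_def)

lemma frontal_lift_normal_covector: "frontal_lift A f (projectivize \<circ> normal_covector)"
  unfolding frontal_lift_def
proof (intro conjI allI smooth_projectivize_normal_covector)
  show "\<forall>(U, \<phi>)\<in>A. \<forall>(D, \<kappa>)\<in>proj_cotangent_charts. \<forall>p\<in>U. (projectivize \<circ> normal_covector) p \<in> D \<longrightarrow>
      (\<forall>v. differential (U, \<phi>) (\<kappa> \<circ> (projectivize \<circ> normal_covector)) p v \<in>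
        contact_hyperplane (D, \<kappa>) ((projectivize \<circ> normal_covector) p))"
    unfolding proj_cotangent_charts_eq
    using projectivize_normal_covector_contact by auto
qed (use projectivize_normal_covector_bundle in auto)

lemma co_orientable_frontal_of_normal: "co_orientable_frontal A f"
  unfolding co_orientable_frontal_def frontal_def
proof (intro conjI f_map)
  show "\<exists>L. frontal_lift A f L" by (rule exI[of _ "projectivize \<circ> normal_covector"]) (rule frontal_lift_normal_covector)
  show "\<exists>L. frontal_lift A f L \<and> (\<exists>K. (\<forall>p. K p \<in> cotangent_bundle \<and> projectivize (K p) = L p) \<and>
      smooth_map A cotangent_charts K)"
    by (intro exI[of _ "projectivize \<circ> normal_covector"] exI[of _ normal_covector] conjI allI
        frontal_lift_normal_covector normal_covector_cotangent smooth_normal_covector) simp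
qed

end

theorem corollary4p3:
  fixes A :: "('a::{t2_space, second_countable_topology} set \<times> ('a \<Rightarrow> real^2)) set"
    and f :: "'a \<Rightarrow> real^4"
  assumes "smooth_atlas A" and "connected (UNIV :: 'a set)" and "cmc1_face A f"
  shows "(\<exists>\<eta>. normal_vector_field A f \<eta> \<and> face_real_analytic A f \<eta>) \<and> co_orientable_frontal A f"
proof -
  note face = assms(1,3)
  have "smooth_map A S31_charts f" using assms(3) by (simp add: cmc1_face_def)
  from co_orientable_frontal_of_normal[OF assms(1) this face_in_S31[OF face] face_smooth[OF face]
      face_normal_smooth[OF face] normal_vector_field_face_normal[OF face]]
    normal_vector_field_face_normal[OF face] face_real_analytic_face_normal[OF face]
  show ?thesis by blast
qed

end
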